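(* Let $M$ be a compact two-dimensional smooth manifold and let $f\in C^1(M)$ have persistent critical set. Then for every $C^1$-neighborhood $\mathcal{U}$ of $f$ there exists $g\in\mathcal{U}$ whose critical set $S_g$ has non-empty interior in $M$.
   Context: $C^1(M)$ is the space of $C^1$ maps $M\to M$ (not necessarily invertible) with the $C^1$ topology. For $g\in C^1(M)$, the critical set is $S_g=\{p\in M: Dg_p\text{ is not invertible}\}$. The critical set of $f$ is persistent if there is a $C^1$-neighborhood of $f$ such that every map $g$ in it has $S_g\neq\emptyset$. *)

theory Defs
  imports "HOL-Analysis.Analysis"
begin

section \<open>Maps of class \<open>C\<^sup>k\<close> between Euclidean spaces\<close>

text \<open>Intended for open \<^term>\<open>S\<close>. In finite dimension the derivative
  \<open>x \<mapsto> Df\<^sub>x\<close> is \<open>C\<^sup>k\<close> as an operator-valued map iff \<open>x \<mapsto> Df\<^sub>x v\<close> is \<open>C\<^sup>k\<close> for every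
  fixed \<open>v\<close>.\<close>

primrec Ck_on ::
  "nat \<Rightarrow> 'e::euclidean_space set \<Rightarrow> ('e \<Rightarrow> 'f::euclidean_space) \<Rightarrow> bool" where
  "Ck_on 0 S f = continuous_on S f"
| "Ck_on (Suc k) S f =
     ((\<forall>x\<in>S. f differentiable (at x)) \<and> (\<forall>v. Ck_on k S (\<lambda>x. frechet_derivative f (at x) v)))"

section \<open>Smooth manifolds\<close>

text \<open>A chart is a domain together with a coordinate map; values of the coordinate map outside
  the domain are irrelevant.\<close>

type_synonym ('a, 'e) chart = "'a set \<times> ('a \<Rightarrow> 'e)"

definition is_chart :: "'a topology \<Rightarrow> ('a, 'e::euclidean_space) chart \<Rightarrow> bool" where
  "is_chart X c \<longleftrightarrow>
     openin X (fst c) \<and> open (snd c ` fst c) \<and>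
     homeomorphic_map (subtopology X (fst c)) (top_of_set (snd c ` fst c)) (snd c)"

text \<open>For charts \<open>c = (U, \<phi>)\<close> and \<open>d = (V, \<psi>)\<close>, the local representative
  \<open>\<psi> \<circ> f \<circ> \<phi>\<^sup>-\<^sup>1\<close> of a map \<open>f\<close> and its domain \<open>\<phi>(U \<inter> f\<^sup>-\<^sup>1(V))\<close>. For \<open>f = id\<close> these are
  the transition map from \<open>c\<close> to \<open>d\<close> and its domain.\<close>

definition coord_rep ::
  "('a, 'e::euclidean_space) chart \<Rightarrow> ('a, 'e) chart \<Rightarrow> ('a \<Rightarrow> 'a) \<Rightarrow> 'e \<Rightarrow> 'e" where
  "coord_rep c d f = snd d \<circ> f \<circ> inv_into (fst c) (snd c)"

definition coord_dom ::
  "('a, 'e::euclidean_space) chart \<Rightarrow> ('a, 'e) chart \<Rightarrow> ('a \<Rightarrow> 'a) \<Rightarrow> 'e set" where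
  "coord_dom c d f = snd c ` {p \<in> fst c. f p \<in> fst d}"

text \<open>A smooth manifold without boundary of dimension \<open>DIM('e)\<close> with underlying topological
  space \<open>X\<close>, its smooth structure being given by an atlas \<open>A\<close>, which may but need not be
  maximal.\<close>

definition smooth_manifold :: "'a topology \<Rightarrow> ('a, 'e::euclidean_space) chart set \<Rightarrow> bool" where
  "smooth_manifold X A \<longleftrightarrow>
     Hausdorff_space X \<and>
     (\<exists>\<B>. countable \<B> \<and> openin X = arbitrary union_of (\<lambda>B. B \<in> \<B>)) \<and>
     (\<forall>c\<in>A. is_chart X c) \<and>
     (\<Union>c\<in>A. fst c) = topspace X \<and>
     (\<forall>c\<in>A. \<forall>d\<in>A. \<forall>k. Ck_on k (coord_dom c d id) (coord_rep c d id))"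

section \<open>Tangent spaces and derivatives\<close>

definition charts_at :: "('a, 'e::euclidean_space) chart set \<Rightarrow> 'a \<Rightarrow> ('a, 'e) chart set" where
  "charts_at A p = {c \<in> A. p \<in> fst c}"

text \<open>A tangent vector at \<open>p\<close> is a family of coordinate vectors, one for each chart around \<open>p\<close>,
  that transforms by the derivatives of the transition maps.\<close>

definition tangent_space ::
  "('a, 'e::euclidean_space) chart set \<Rightarrow> 'a \<Rightarrow> (('a, 'e) chart \<Rightarrow> 'e) set" where
  "tangent_space A p =
     {\<xi> \<in> charts_at A p \<rightarrow>\<^sub>E UNIV.
        \<forall>c\<in>charts_at A p. \<forall>d\<in>charts_at A p.
          \<xi> d = frechet_derivative (coord_rep c d id) (at (snd c p)) (\<xi> c)}"

text \<open>The derivative \<open>Df\<^sub>p : T\<^sub>pM \<rightarrow> T\<^bsub>f(p)\<^esub>M\<close>. By the chain rule, the result does not depend on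
  the choice of the chart \<open>c\<close>.\<close>

definition tangent_map ::
  "('a, 'e::euclidean_space) chart set \<Rightarrow> ('a \<Rightarrow> 'a) \<Rightarrow> 'a \<Rightarrow>
     (('a, 'e) chart \<Rightarrow> 'e) \<Rightarrow> (('a, 'e) chart \<Rightarrow> 'e)" where
  "tangent_map A f p \<xi> =
     (let c = (SOME c. c \<in> charts_at A p)
      in (\<lambda>d\<in>charts_at A (f p). frechet_derivative (coord_rep c d f) (at (snd c p)) (\<xi> c)))"

section \<open>The space of \<open>C\<^sup>1\<close> self-maps\<close>

definition C1_maps :: "'a topology \<Rightarrow> ('a, 'e::euclidean_space) chart set \<Rightarrow> ('a \<Rightarrow> 'a) set" where
  "C1_maps X A =
     {f \<in> topspace X \<rightarrow>\<^sub>E topspace X.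
        continuous_map X X f \<and>
        (\<forall>c\<in>A. \<forall>d\<in>A. Ck_on 1 (coord_dom c d f) (coord_rep c d f))}"

text \<open>The usual subbasic sets of the (weak) \<open>C\<^sup>1\<close> topology: maps that are \<open>\<epsilon>\<close>-close to \<open>f\<close>,
  together with their first derivatives, over the compact set \<open>K\<close> in the charts \<open>c\<close> and \<open>d\<close>.
  On a compact manifold, weak and strong topology agree.\<close>

definition C1_subbasic ::
  "'a topology \<Rightarrow> ('a, 'e::euclidean_space) chart set \<Rightarrow> ('a \<Rightarrow> 'a) \<Rightarrow>
     ('a, 'e) chart \<Rightarrow> ('a, 'e) chart \<Rightarrow> 'a set \<Rightarrow> real \<Rightarrow> ('a \<Rightarrow> 'a) set" where
  "C1_subbasic X A f c d K \<epsilon> =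
     {g \<in> C1_maps X A.
        g ` K \<subseteq> fst d \<and>
        (\<forall>x \<in> snd c ` K.
           norm (coord_rep c d g x - coord_rep c d f x) < \<epsilon> \<and>
           onorm (\<lambda>v. frechet_derivative (coord_rep c d g) (at x) v
                    - frechet_derivative (coord_rep c d f) (at x) v) < \<epsilon>)}"

definition C1_topology ::
  "'a topology \<Rightarrow> ('a, 'e::euclidean_space) chart set \<Rightarrow> ('a \<Rightarrow> 'a) topology" where
  "C1_topology X A =
     topology_generated_by
       {C1_subbasic X A f c d K \<epsilon> | f c d K \<epsilon>.
          f \<in> C1_maps X A \<and> c \<in> A \<and> d \<in> A \<and>
          compactin X K \<and> K \<subseteq> fst c \<and> f ` K \<subseteq> fst d \<and> 0 < \<epsilon>}"

definition C1_neighborhood ::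
  "'a topology \<Rightarrow> ('a, 'e::euclidean_space) chart set \<Rightarrow> ('a \<Rightarrow> 'a) \<Rightarrow> ('a \<Rightarrow> 'a) set \<Rightarrow> bool" where
  "C1_neighborhood X A f \<U> \<longleftrightarrow>
     \<U> \<subseteq> C1_maps X A \<and> (\<exists>\<W>. openin (C1_topology X A) \<W> \<and> f \<in> \<W> \<and> \<W> \<subseteq> \<U>)"

section \<open>Critical sets\<close>

text \<open>The derivative is linear, so it is invertible iff it is bijective.\<close>

definition critical_set ::
  "'a topology \<Rightarrow> ('a, 'e::euclidean_space) chart set \<Rightarrow> ('a \<Rightarrow> 'a) \<Rightarrow> 'a set" where
  "critical_set X A g =
     {p \<in> topspace X. \<not> bij_betw (tangent_map A g p) (tangent_space A p) (tangent_space A (g p))}"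

definition persistent_critical_set ::
  "'a topology \<Rightarrow> ('a, 'e::euclidean_space) chart set \<Rightarrow> ('a \<Rightarrow> 'a) \<Rightarrow> bool" where
  "persistent_critical_set X A f \<longleftrightarrow>
     (\<exists>\<U>. C1_neighborhood X A f \<U> \<and> (\<forall>g\<in>\<U>. critical_set X A g \<noteq> {}))"

end

(* Since f itself lies in the neighbourhood witnessing persistence, f has a critical point p. Near p,
   in charts, replace f on a ball of radius r by its affine Taylor approximation at p, interpolating
   with a cutoff function at scale r. As f is of class C^1, the difference between f and this
   approximation is o(r) with derivative o(1), which absorbs the gradient O(1/r) of the cutoff;
   hence the perturbed maps converge to f in the C^1 topology as r tends to 0. Their derivative in
   charts is constant, equal to the singular derivative of f at p, on a neighbourhood of p. *)

theory Submission
  imports Defs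
begin

section \<open>Maps of class \<open>C\<^sup>1\<close> between Euclidean spaces\<close>

text \<open>Making the map constant near p would also give a fat critical set, but such a map is in
  general not C^1-close to f; the affine approximation keeps the derivative at p, and only its
  variation near p is removed. Two obstacles shape the details. The image of a chart need not be
  convex, so interpolating between two points of it may leave it; the construction therefore works
  only below a radius at which all interpolated values stay in the target chart. And the C^1
  topology is generated by sets centred at arbitrary maps and tested in arbitrary charts over
  arbitrary compact sets, so closeness has to be carried over from the two charts of the
  construction to any other pair. This is done with the chain rule for operator-valued derivatives
  and a pointwise notion of C^1 regularity. Convergence is phrased as a joint limit in the radius
  and the point, since the region where the map changes shrinks along with the radius.\<close>

definition fderiv ::
  "('e::euclidean_space \<Rightarrow> 'f::euclidean_space) \<Rightarrow> 'e \<Rightarrow> 'e \<Rightarrow>\<^sub>L 'f" where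
  "fderiv F x = Blinfun (frechet_derivative F (at x))"

text \<open>\<open>Blinfun\<close> is meaningful only on bounded linear maps, which
  differentiability supplies. The operator-valued form gives access to the operator norm, to
  composition of operators and to limits of them, whereas \<open>Ck_on\<close> speaks of one
  direction at a time.\<close>

lemma fderiv_apply:
  assumes "F differentiable (at x)"
  shows "blinfun_apply (fderiv F x) = frechet_derivative F (at x)"
  unfolding fderiv_def using assms
  by (intro bounded_linear_Blinfun_apply has_derivative_bounded_linear)
     (auto simp: frechet_derivative_works)

lemma has_derivative_fderiv:
  "F differentiable (at x) \<Longrightarrow> (F has_derivative blinfun_apply (fderiv F x)) (at x)"
  by (simp add: fderiv_apply frechet_derivative_works[symmetric])

lemma fderiv_eqI:
  assumes "(F has_derivative blinfun_apply B) (at x)"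
  shows "fderiv F x = B"
  by (metis assms blinfun_apply_inverse fderiv_def frechet_derivative_at)

lemma frechet_derivative_transform_open:
  assumes "F differentiable (at x)" "open T" "x \<in> T" "\<And>y. y \<in> T \<Longrightarrow> G y = F y"
  shows "frechet_derivative G (at x) = frechet_derivative F (at x)"
proof -
  have "(F has_derivative frechet_derivative F (at x)) (at x)"
    using assms(1) frechet_derivative_works by blast
  then have "(G has_derivative frechet_derivative F (at x)) (at x)"
    using assms(2-4) by (metis has_derivative_transform_within_open)
  then show ?thesis
    by (metis frechet_derivative_at)
qed

text \<open>Regularity at a single point, so that it can be checked in whichever charts are
  convenient there.\<close>

definition C1_near :: "('e::euclidean_space \<Rightarrow> 'f::euclidean_space) \<Rightarrow> 'e \<Rightarrow> bool" where
  "C1_near F x \<longleftrightarrow> (\<exists>T. open T \<and> x \<in> T \<and> Ck_on 1 T F)"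

lemma C1_near_differentiable: "C1_near F x \<Longrightarrow> F differentiable (at x)"
  by (auto simp: C1_near_def)

text \<open>In finite dimension, continuity on each basis vector already gives continuity in
  operator norm.\<close>

lemma Ck_on_1_continuous_on_fderiv:
  assumes "Ck_on 1 S F"
  shows "continuous_on S (fderiv F)"
proof (rule continuous_on_blinfun_componentwise)
  fix i :: 'a
  have "continuous_on S (\<lambda>x. frechet_derivative F (at x) i)"
    using assms by auto
  then show "continuous_on S (\<lambda>x. blinfun_apply (fderiv F x) i)"
    using assms by (auto simp: fderiv_apply cong: continuous_on_cong)
qed

lemma C1_near_isCont_fderiv:
  assumes "C1_near F x"
  shows "isCont (fderiv F) x"
  using assms Ck_on_1_continuous_on_fderiv continuous_on_eq_continuous_at
  unfolding C1_near_def by blast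

lemma Ck_on_1I:
  assumes "\<And>x. x \<in> S \<Longrightarrow> (F has_derivative F' x) (at x)"
    and "\<And>v. continuous_on S (\<lambda>x. F' x v)"
  shows "Ck_on 1 S F"
proof -
  have "frechet_derivative F (at x) = F' x" if "x \<in> S" for x
    using assms(1)[OF that] by (metis frechet_derivative_at)
  moreover have "F differentiable (at x)" if "x \<in> S" for x
    using assms(1)[OF that] differentiable_def by blast
  ultimately show ?thesis
    using assms(2) by (auto cong: continuous_on_cong)
qed

lemma Ck_on_1_iff_C1_near:
  assumes "open S"
  shows "Ck_on 1 S F \<longleftrightarrow> (\<forall>x\<in>S. C1_near F x)"
proof
  assume "\<forall>x\<in>S. C1_near F x"
  note near = this[rule_format]
  show "Ck_on 1 S F"
  proof (rule Ck_on_1I)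
    show "(F has_derivative blinfun_apply (fderiv F x)) (at x)" if "x \<in> S" for x
      using near[OF that] C1_near_differentiable has_derivative_fderiv by blast
    show "continuous_on S (\<lambda>x. blinfun_apply (fderiv F x) v)" for v
      using near C1_near_isCont_fderiv
      by (intro continuous_at_imp_continuous_on ballI) (auto intro!: continuous_intros)
  qed
qed (use assms C1_near_def in blast)

lemma C1_near_transform_open:
  assumes "C1_near F x" "open T" "x \<in> T" "\<And>y. y \<in> T \<Longrightarrow> G y = F y"
  shows "C1_near G x"
proof -
  obtain U where U: "open U" "x \<in> U" "Ck_on 1 U F"
    using assms(1) by (auto simp: C1_near_def)
  have diff: "F differentiable (at y)" if "y \<in> U" for y
    using U that by auto
  have "Ck_on 1 (U \<inter> T) G"
  proof (rule Ck_on_1I)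
    show "(G has_derivative blinfun_apply (fderiv F y)) (at y)" if "y \<in> U \<inter> T" for y
      using has_derivative_fderiv[OF diff] that assms
      by (metis IntE has_derivative_transform_within_open)
    show "continuous_on (U \<inter> T) (\<lambda>y. blinfun_apply (fderiv F y) v)" for v
      using continuous_on_subset[OF Ck_on_1_continuous_on_fderiv[OF U(3)], of "U \<inter> T"]
      by (auto intro!: continuous_intros)
  qed
  then show ?thesis
    unfolding C1_near_def using U assms by (intro exI[of _ "U \<inter> T"]) auto
qed

lemma C1_near_eventually:
  "C1_near F x \<Longrightarrow> eventually (C1_near F) (nhds x)"
  unfolding C1_near_def eventually_nhds by blast

lemma fderiv_compose:
  assumes "F differentiable (at x)" "G differentiable (at (F x))"
  shows "fderiv (\<lambda>y. G (F y)) x = fderiv G (F x) o\<^sub>L fderiv F x"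
proof (rule fderiv_eqI)
  have "(G \<circ> F has_derivative (blinfun_apply (fderiv G (F x)) \<circ> blinfun_apply (fderiv F x))) (at x)"
    using assms by (intro diff_chain_at has_derivative_fderiv)
  then show "((\<lambda>y. G (F y)) has_derivative blinfun_apply (fderiv G (F x) o\<^sub>L fderiv F x)) (at x)"
    by (simp add: o_def blinfun_compose.rep_eq)
qed

lemma C1_near_compose:
  assumes "C1_near F x" "C1_near G (F x)"
  shows "C1_near (\<lambda>y. G (F y)) x"
proof -
  obtain U where U: "open U" "x \<in> U" "Ck_on 1 U F"
    using assms(1) by (auto simp: C1_near_def)
  obtain V where V: "open V" "F x \<in> V" "Ck_on 1 V G"
    using assms(2) by (auto simp: C1_near_def)
  have dF: "F differentiable (at y)" if "y \<in> U" for y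
    using U that by auto
  have dG: "G differentiable (at y)" if "y \<in> V" for y
    using V that by auto
  have cF: "continuous_on U F"
    using dF by (intro continuous_at_imp_continuous_on) (auto intro: differentiable_imp_continuous_within)
  define T where "T = U \<inter> F -` V"
  have T: "open T" "x \<in> T" "T \<subseteq> U" "F ` T \<subseteq> V"
    using continuous_open_preimage[OF cF U(1) V(1)] U V by (auto simp: T_def)
  have "Ck_on 1 T (\<lambda>y. G (F y))"
  proof (rule Ck_on_1I)
    show "((\<lambda>y. G (F y)) has_derivative blinfun_apply (fderiv G (F y) o\<^sub>L fderiv F y)) (at y)"
      if "y \<in> T" for y
    proof -
      have "F differentiable (at y)" "G differentiable (at (F y))"
        using that T dF dG by auto
      moreover from this have "(\<lambda>y. G (F y)) differentiable (at y)"
        using differentiable_chain_at[of F y G] by (simp add: o_def)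
      ultimately show ?thesis
        using has_derivative_fderiv fderiv_compose by metis
    qed
    have "continuous_on T (\<lambda>y. fderiv G (F y))"
      by (rule continuous_on_compose2[OF Ck_on_1_continuous_on_fderiv[OF V(3)]
            continuous_on_subset[OF cF T(3)] T(4)])
    moreover have "continuous_on T (fderiv F)"
      using continuous_on_subset[OF Ck_on_1_continuous_on_fderiv[OF U(3)] T(3)] .
    ultimately show "continuous_on T (\<lambda>y. blinfun_apply (fderiv G (F y) o\<^sub>L fderiv F y) v)" for v
      by (auto intro!: continuous_intros)
  qed
  then show ?thesis
    using T by (auto simp: C1_near_def)
qed

lemma onorm_frechet_derivative_diff:
  assumes "F differentiable (at x)" "G differentiable (at x)"
  shows "onorm (\<lambda>v. frechet_derivative F (at x) v - frechet_derivative G (at x) v)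
           = norm (fderiv F x - fderiv G x)"
  using assms by (simp add: norm_blinfun.rep_eq fderiv_apply minus_blinfun.rep_eq)

section \<open>Replacing a \<open>C\<^sup>1\<close> map by its linearization near a point\<close>

definition ramp :: "real \<Rightarrow> real" where "ramp t = (max 0 t)\<^sup>2"

text \<open>Squaring smooths the corner of \<open>max 0\<close> just enough for class C^1: at 0 the
  difference quotient is \<open>max 0 h\<close>, which tends to 0.\<close>

lemma DERIV_ramp: "(ramp has_real_derivative 2 * max 0 t) (at t)"
proof -
  consider "t < 0" | "t > 0" | "t = 0" by linarith
  then show ?thesis
  proof cases
    case 1
    have "((\<lambda>_. 0) has_real_derivative 0) (at t)" by simp
    then have "(ramp has_real_derivative 0) (at t)"
      by (rule has_field_derivative_transform_within_open[where S = "{..<0}"])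
        (use 1 in \<open>auto simp: ramp_def\<close>)
    then show ?thesis using 1 by simp
  next
    case 2
    have "((\<lambda>s. s\<^sup>2) has_real_derivative 2 * t) (at t)"
      by (auto intro!: derivative_eq_intros)
    then have "(ramp has_real_derivative 2 * t) (at t)"
      by (rule has_field_derivative_transform_within_open[where S = "{0<..}"])
        (use 2 in \<open>auto simp: ramp_def\<close>)
    then show ?thesis using 2 by simp
  next
    case 3
    have "((\<lambda>h. max 0 h) \<longlongrightarrow> max 0 (0::real)) (at 0)"
      by (intro tendsto_intros)
    then have "((\<lambda>h. max 0 h) \<longlongrightarrow> (0::real)) (at 0)"
      by simp
    then have "((\<lambda>h. (ramp (0 + h) - ramp 0) / h) \<longlongrightarrow> 0) (at 0)"
      by (rule Lim_transform_eventually)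
        (auto simp: ramp_def eventually_at_filter max_def power2_eq_square)
    then show ?thesis using 3 by (simp add: DERIV_def)
  qed
qed

text \<open>Two nested ramps give 1 for t \<le> 0, the polynomial (1 - t^2)^2 on [0, 1], and 0 for t
  \<ge> 1.\<close>

definition cutoff :: "real \<Rightarrow> real" where "cutoff t = ramp (1 - ramp t)"

definition cutoff' :: "real \<Rightarrow> real" where
  "cutoff' t = - (4 * max 0 (1 - ramp t) * max 0 t)"

lemma DERIV_cutoff: "(cutoff has_real_derivative cutoff' t) (at t)"
proof -
  have "((\<lambda>s. 1 - ramp s) has_real_derivative 0 - 2 * max 0 t) (at t)"
    by (intro derivative_intros DERIV_ramp)
  from DERIV_chain2[OF DERIV_ramp this] show ?thesis
    by (simp add: cutoff_def[abs_def] cutoff'_def algebra_simps)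
qed

lemma cutoff_bounds: "0 \<le> cutoff t" "cutoff t \<le> 1"
proof -
  have "0 \<le> ramp t" by (simp add: ramp_def)
  then have "max 0 (1 - ramp t) \<le> 1" by simp
  then show "cutoff t \<le> 1"
    unfolding cutoff_def ramp_def[of "1 - _"] by (intro power_le_one) auto
qed (simp add: cutoff_def ramp_def)

lemma cutoff_eq_1: "t \<le> 0 \<Longrightarrow> cutoff t = 1"
  by (simp add: cutoff_def ramp_def)

lemma one_le_ramp: "1 \<le> t \<Longrightarrow> 1 \<le> ramp t"
  by (simp add: ramp_def)

lemma cutoff_eq_0: "1 \<le> t \<Longrightarrow> cutoff t = 0"
  using one_le_ramp[of t] by (simp add: cutoff_def ramp_def[of "1 - _"])

lemma continuous_on_cutoff': "continuous_on S cutoff'"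
  unfolding cutoff'_def ramp_def by (intro continuous_intros)

text \<open>The weight \<open>t + 1\<close> will be the squared quotient of the distance from the
  centre by the radius, hence t \<ge> -1. The derivative vanishes unless 0 < t < 1; there it is at
  most 4 in absolute value and the weight at most 2, whence 8.\<close>

lemma cutoff'_bound:
  assumes "t \<ge> -1"
  shows "\<bar>cutoff' t\<bar> * (t + 1) \<le> 8"
proof -
  consider "t \<le> 0" | "0 < t" "t < 1" | "1 \<le> t" by linarith
  then show ?thesis
  proof cases
    case 1 then show ?thesis by (simp add: cutoff'_def)
  next
    case 2
    have "0 \<le> ramp t" by (simp add: ramp_def)
    then have "max 0 (1 - ramp t) * max 0 t \<le> 1 * 1"
      using 2 by (intro mult_mono) auto
    then have "\<bar>cutoff' t\<bar> \<le> 4"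
      by (simp add: cutoff'_def abs_mult)
    then have "\<bar>cutoff' t\<bar> * (t + 1) \<le> 4 * 2"
      using 2 by (intro mult_mono) auto
    then show ?thesis by simp
  next
    case 3 then show ?thesis
      using one_le_ramp[of t] by (simp add: cutoff'_def)
  qed
qed

section \<open>Blending a map with its affine Taylor approximation\<close>

definition linearize ::
  "('e::euclidean_space \<Rightarrow> 'f::euclidean_space) \<Rightarrow> 'e \<Rightarrow> real \<Rightarrow> 'e \<Rightarrow> 'f" where
  "linearize F a r x =
     F x + cutoff ((x - a) \<bullet> (x - a) / r\<^sup>2 - 1) *\<^sub>R (F a + fderiv F a (x - a) - F x)"

text \<open>The cutoff is fed with the squared distance, scaled and shifted by 1: it is a polynomial
  in x, hence also differentiable at the centre, and it is at most 0 precisely within radius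
  r.\<close>

lemma linearize_near:
  assumes "r > 0" "dist x a \<le> r"
  shows "linearize F a r x = F a + fderiv F a (x - a)"
proof -
  have "norm (x - a) ^ 2 \<le> r ^ 2"
    using assms by (intro power_mono) (auto simp: dist_norm)
  then have "(x - a) \<bullet> (x - a) / r\<^sup>2 - 1 \<le> 0"
    using assms by (simp add: power2_norm_eq_inner)
  then show ?thesis by (simp add: linearize_def cutoff_eq_1)
qed

lemma linearize_far:
  assumes "r > 0" "dist x a \<ge> 2 * r"
  shows "linearize F a r x = F x"
proof -
  have "(2 * r) ^ 2 \<le> norm (x - a) ^ 2"
    using assms by (intro power_mono) (auto simp: dist_norm)
  then have "4 * r\<^sup>2 \<le> (x - a) \<bullet> (x - a)"
    by (simp only: power2_norm_eq_inner power_mult_distrib) simp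
  \<comment> \<open>The cutoff vanishes as soon as the squared distance reaches
    \<open>2 * r\<^sup>2\<close>; the radius \<open>2 * r\<close> is a generous round
    choice.\<close>
  then have "2 * r\<^sup>2 \<le> (x - a) \<bullet> (x - a)"
    using zero_le_power2[of r] by linarith
  then have "1 \<le> (x - a) \<bullet> (x - a) / r\<^sup>2 - 1"
    using assms(1) by (simp add: le_divide_eq)
  then show ?thesis by (simp add: linearize_def cutoff_eq_0)
qed

lemma has_derivative_linearize:
  assumes "F differentiable (at x)" "r > 0"
  shows "(linearize F a r has_derivative
     (\<lambda>v. fderiv F x v
        + cutoff ((x - a) \<bullet> (x - a) / r\<^sup>2 - 1) *\<^sub>R (fderiv F a v - fderiv F x v)
        + (cutoff' ((x - a) \<bullet> (x - a) / r\<^sup>2 - 1) * (2 * ((x - a) \<bullet> v) / r\<^sup>2)) *\<^sub>R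
            (F a + fderiv F a (x - a) - F x))) (at x)"
proof -
  have "((\<lambda>x. (x - a) \<bullet> (x - a) / r\<^sup>2 - 1) has_derivative (\<lambda>v. 2 * ((x - a) \<bullet> v) / r\<^sup>2)) (at x)"
    using assms(2)
    by (auto intro!: derivative_eq_intros simp: inner_commute power2_eq_square field_simps)
  from has_derivative_compose[OF this DERIV_cutoff[unfolded has_field_derivative_def]]
  have cut: "((\<lambda>x. cutoff ((x - a) \<bullet> (x - a) / r\<^sup>2 - 1)) has_derivative
     (\<lambda>v. cutoff' ((x - a) \<bullet> (x - a) / r\<^sup>2 - 1) * (2 * ((x - a) \<bullet> v) / r\<^sup>2))) (at x)" .
  have "((\<lambda>x. F a + fderiv F a (x - a)) has_derivative (\<lambda>v. fderiv F a v)) (at x)"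
    by (auto intro!: derivative_eq_intros)
  from has_derivative_diff[OF this has_derivative_fderiv[OF assms(1)]]
  have "((\<lambda>x. F a + fderiv F a (x - a) - F x) has_derivative (\<lambda>v. fderiv F a v - fderiv F x v)) (at x)" .
  from has_derivative_add[OF has_derivative_fderiv[OF assms(1)] has_derivative_scaleR[OF cut this]]
  show ?thesis
    unfolding linearize_def by (simp add: add.assoc)
qed

lemma C1_near_linearize:
  assumes "C1_near F x" "r > 0"
  shows "C1_near (linearize F a r) x"
proof -
  obtain U where U: "open U" "x \<in> U" "Ck_on 1 U F"
    using assms(1) by (auto simp: C1_near_def)
  have dF: "F differentiable (at y)" if "y \<in> U" for y
    using U that by auto
  have cF: "continuous_on U F"
    using dF by (intro continuous_at_imp_continuous_on) (auto intro: differentiable_imp_continuous_within)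
  note cD = Ck_on_1_continuous_on_fderiv[OF U(3)]
  have q: "continuous_on U (\<lambda>x. (x - a) \<bullet> (x - a) / r\<^sup>2 - 1)"
    using assms(2) by (intro continuous_intros) auto
  have c: "continuous_on UNIV cutoff"
    by (intro continuous_at_imp_continuous_on ballI DERIV_isCont[OF DERIV_cutoff])
  note c1 = continuous_on_compose2[OF c q subset_UNIV]
    continuous_on_compose2[OF continuous_on_cutoff' q subset_UNIV]
  have "Ck_on 1 U (linearize F a r)"
  proof (rule Ck_on_1I[OF has_derivative_linearize[OF dF assms(2)]])
    show "continuous_on U (\<lambda>x. fderiv F x v
        + cutoff ((x - a) \<bullet> (x - a) / r\<^sup>2 - 1) *\<^sub>R (fderiv F a v - fderiv F x v)
        + (cutoff' ((x - a) \<bullet> (x - a) / r\<^sup>2 - 1) * (2 * ((x - a) \<bullet> v) / r\<^sup>2)) *\<^sub>R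
            (F a + fderiv F a (x - a) - F x))" for v
      using assms(2) by (intro continuous_intros cF cD c1) auto
  qed
  then show ?thesis using U by (auto simp: C1_near_def)
qed

text \<open>The cutoff at scale \<open>r\<close> has gradient of order \<open>1/r\<close>, but is only applied to a remainder that
  is \<open>o(r)\<close> on the support of this gradient; so the estimate is uniform in \<open>r\<close>.\<close>

lemma fderiv_linearize_bound:
  assumes "F differentiable (at x)" "r > 0"
    and "norm (fderiv F x - fderiv F a) \<le> \<eta>"
    and "norm (F x - F a - fderiv F a (x - a)) \<le> \<eta> * norm (x - a)"
  shows "norm (fderiv (linearize F a r) x - fderiv F a) \<le> 17 * \<eta>"
proof -
  define t where "t = (x - a) \<bullet> (x - a) / r\<^sup>2 - 1"
  define h where "h = F a + fderiv F a (x - a) - F x"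
  have eta: "\<eta> \<ge> 0" using assms(3) norm_ge_zero order_trans by blast
  have h: "norm h \<le> \<eta> * norm (x - a)"
    using assms(4) unfolding h_def by (metis diff_diff_add norm_minus_commute)
  have t: "t \<ge> -1" by (simp add: t_def)
  have der: "(linearize F a r has_derivative
     (\<lambda>v. fderiv F x v + cutoff t *\<^sub>R (fderiv F a v - fderiv F x v)
        + (cutoff' t * (2 * ((x - a) \<bullet> v) / r\<^sup>2)) *\<^sub>R h)) (at x)"
    using has_derivative_linearize[OF assms(1,2)] by (simp add: t_def h_def)
  have app: "blinfun_apply (fderiv (linearize F a r) x) v =
      fderiv F x v + cutoff t *\<^sub>R (fderiv F a v - fderiv F x v)
        + (cutoff' t * (2 * ((x - a) \<bullet> v) / r\<^sup>2)) *\<^sub>R h" for v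
    using fderiv_apply[of "linearize F a r" x] frechet_derivative_at[OF der] der
    unfolding differentiable_def by (metis (no_types, lifting))
  show ?thesis
  proof (rule norm_blinfun_bound)
    fix v
    have 1: "norm ((1 - cutoff t) *\<^sub>R ((fderiv F x - fderiv F a) v)) \<le> 1 * (\<eta> * norm v)"
      unfolding norm_scaleR
    proof (rule mult_mono)
      show "norm (blinfun_apply (fderiv F x - fderiv F a) v) \<le> \<eta> * norm v"
        using norm_blinfun[of "fderiv F x - fderiv F a" v] assms(3)
        by (meson mult_right_mono norm_ge_zero order_trans)
    qed (use cutoff_bounds[of t] in auto)
    have "\<bar>(x - a) \<bullet> v\<bar> * norm h \<le> (norm (x - a) * norm v) * (\<eta> * norm (x - a))"
      using h by (intro mult_mono Cauchy_Schwarz_ineq2) (auto simp: eta)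
    \<comment> \<open>The squared distance is \<open>r\<^sup>2 * (t + 1)\<close>: one factor
      \<open>norm (x - a)\<close> comes from the gradient of the cutoff, the other from the
      remainder, and together they absorb the division by \<open>r\<^sup>2\<close>.\<close>
    also have "\<dots> = \<eta> * norm v * (r\<^sup>2 * (t + 1))"
      using assms(2) by (simp add: t_def power2_norm_eq_inner[symmetric] power2_eq_square)
    finally have "\<bar>cutoff' t\<bar> * (2 / r\<^sup>2) * (\<bar>(x - a) \<bullet> v\<bar> * norm h)
        \<le> \<bar>cutoff' t\<bar> * (2 / r\<^sup>2) * (\<eta> * norm v * (r\<^sup>2 * (t + 1)))"
      by (intro mult_left_mono) auto
    also have "\<dots> = 2 * \<eta> * norm v * (\<bar>cutoff' t\<bar> * (t + 1))"
      using assms(2) by simp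
    also have "\<dots> \<le> 2 * \<eta> * norm v * 8"
      using eta by (intro mult_left_mono cutoff'_bound t) auto
    finally have 2: "norm ((cutoff' t * (2 * ((x - a) \<bullet> v) / r\<^sup>2)) *\<^sub>R h) \<le> 16 * \<eta> * norm v"
      by (simp add: abs_mult mult_ac)
    \<comment> \<open>Regrouping around the derivative at \<open>a\<close> leaves a damped
      oscillation of the derivative, contributing 1, and the gradient term, contributing 2 * 8; the
      sum is 17.\<close>
    have "blinfun_apply (fderiv (linearize F a r) x - fderiv F a) v =
        (1 - cutoff t) *\<^sub>R ((fderiv F x - fderiv F a) v)
        + (cutoff' t * (2 * ((x - a) \<bullet> v) / r\<^sup>2)) *\<^sub>R h"
      by (simp add: app blinfun.bilinear_simps algebra_simps)
    also have "norm \<dots> \<le> 1 * (\<eta> * norm v) + 16 * \<eta> * norm v"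
      using 1 2 by (rule norm_triangle_mono)
    finally show "norm (blinfun_apply (fderiv (linearize F a r) x - fderiv F a) v) \<le> 17 * \<eta> * norm v"
      by simp
  qed (use eta in simp)
qed

lemma eventually_remainder_le:
  assumes "(F has_derivative F') (at a)" "\<eta> > 0"
  shows "eventually (\<lambda>x. norm (F x - F a - F' (x - a)) \<le> \<eta> * norm (x - a)) (nhds a)"
  using assms unfolding has_derivative_at_alt eventually_nhds_metric dist_norm by blast

text \<open>A joint limit is available because the preceding estimate holds for every positive r:
  only x has to be close to \<open>a\<close>, and r may depend on x in any way.\<close>

lemma tendsto_fderiv_linearize:
  assumes "C1_near F a"
  shows "((\<lambda>(r, x). fderiv (linearize F a r) x) \<longlongrightarrow> fderiv F a) (at_right 0 \<times>\<^sub>F nhds a)"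
proof (rule tendstoI)
  fix e :: real assume e: "e > 0"
  \<comment> \<open>Any divisor above 17 makes the final inequality strict.\<close>
  define \<eta> where "\<eta> = e / 18"
  have eta: "\<eta> > 0" "17 * \<eta> < e" using e by (auto simp: \<eta>_def)
  have "eventually (\<lambda>x. norm (F x - F a - fderiv F a (x - a)) \<le> \<eta> * norm (x - a)) (nhds a)"
    by (rule eventually_remainder_le[OF has_derivative_fderiv eta(1)])
      (rule C1_near_differentiable[OF assms])
  moreover have "eventually (\<lambda>x. dist (fderiv F x) (fderiv F a) < \<eta>) (nhds a)"
    using C1_near_isCont_fderiv[OF assms] eta(1)
    unfolding isCont_def tendsto_at_iff_tendsto_nhds by (rule tendstoD)
  moreover have "eventually (\<lambda>x. F differentiable (at x)) (nhds a)"
    using C1_near_eventually[OF assms] by (rule eventually_mono) (rule C1_near_differentiable)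
  ultimately have "eventually (\<lambda>x. \<forall>r>0. dist (fderiv (linearize F a r) x) (fderiv F a) < e) (nhds a)"
  proof eventually_elim
    case (elim x)
    show ?case
    proof (intro allI impI)
      fix r :: real assume "r > 0"
      with elim have "norm (fderiv (linearize F a r) x - fderiv F a) \<le> 17 * \<eta>"
        by (intro fderiv_linearize_bound) (auto simp: dist_norm)
      then show "dist (fderiv (linearize F a r) x) (fderiv F a) < e"
        using eta(2) by (simp add: dist_norm)
    qed
  qed
  moreover have "eventually (\<lambda>r::real. r > 0) (at_right 0)"
    by (rule eventually_at_right_less)
  ultimately show "eventually (\<lambda>p. dist (case p of (r, x) \<Rightarrow> fderiv (linearize F a r) x) (fderiv F a) < e)
      (at_right 0 \<times>\<^sub>F nhds a)"
    unfolding eventually_prod_filter by (auto intro!: exI)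
qed

text \<open>The deviation from \<open>F a\<close> is a convex combination of
  \<open>F x - F a\<close> and the linear term, and both vanish in the limit whatever the weight.
  The estimate is thus uniform in r, and the filter \<open>R\<close> can be arbitrary.\<close>

lemma tendsto_linearize:
  assumes "isCont F a"
  shows "((\<lambda>(r, x). linearize F a r x) \<longlongrightarrow> F a) (R \<times>\<^sub>F nhds a)"
proof (rule tendstoI)
  fix e :: real assume e: "e > 0"
  have "((\<lambda>x. norm (F x - F a) + norm (fderiv F a (x - a))) \<longlongrightarrow>
        norm (F a - F a) + norm (fderiv F a (a - a))) (nhds a)"
    using assms
    by (intro tendsto_intros)
      (auto simp: continuous_at tendsto_at_iff_tendsto_nhds filterlim_ident)
  then have *: "eventually (\<lambda>x. norm (F x - F a) + norm (fderiv F a (x - a)) < e) (nhds a)"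
    using e by (auto intro: order_tendstoD)
  have "dist (linearize F a r x) (F a) \<le> norm (F x - F a) + norm (fderiv F a (x - a))" for r x
  proof -
    define s where "s = cutoff ((x - a) \<bullet> (x - a) / r\<^sup>2 - 1)"
    have "linearize F a r x - F a = (1 - s) *\<^sub>R (F x - F a) + s *\<^sub>R fderiv F a (x - a)"
      by (simp add: linearize_def s_def algebra_simps)
    also have "norm \<dots> \<le> 1 * norm (F x - F a) + 1 * norm (fderiv F a (x - a))"
      unfolding s_def
      by (intro norm_triangle_mono, unfold norm_scaleR)
        (intro mult_right_mono; use cutoff_bounds in \<open>simp add: abs_le_iff\<close>)+
    finally show ?thesis by (simp add: dist_norm)
  qed
  then have "eventually (\<lambda>x. \<forall>r. dist (linearize F a r x) (F a) < e) (nhds a)"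
    by (intro eventually_mono[OF *]) (meson order_le_less_trans)
  then show "eventually (\<lambda>p. dist (case p of (r, x) \<Rightarrow> linearize F a r x) (F a) < e) (R \<times>\<^sub>F nhds a)"
    unfolding eventually_prod_filter
    by (intro exI[of _ "\<lambda>_. True"] exI[of _ "\<lambda>x. \<forall>r. dist (linearize F a r x) (F a) < e"]) auto
qed

section \<open>Charts\<close>

text \<open>Unlike \<open>C1_maps\<close> this does not prescribe the value \<open>undefined\<close>
  off the space, so that \<open>id\<close> qualifies and transition maps can be treated as local
  representatives of a self-map.\<close>

definition C1_self_map ::
  "'a topology \<Rightarrow> ('a, 'e::euclidean_space) chart set \<Rightarrow> ('a \<Rightarrow> 'a) \<Rightarrow> bool" where
  "C1_self_map X A g \<longleftrightarrow> continuous_map X X g \<and>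
     (\<forall>c\<in>A. \<forall>d\<in>A. Ck_on 1 (coord_dom c d g) (coord_rep c d g))"

lemma C1_self_map_continuous: "C1_self_map X A g \<Longrightarrow> continuous_map X X g"
  by (simp add: C1_self_map_def)

lemma charts_at_iff: "c \<in> charts_at A p \<longleftrightarrow> c \<in> A \<and> p \<in> fst c"
  by (simp add: charts_at_def)

locale manifold =
  fixes X :: "'a topology" and A :: "('a, 'e::euclidean_space) chart set"
  assumes mfd: "smooth_manifold X A"
begin

lemma chart:
  assumes "c \<in> A"
  shows chart_open: "openin X (fst c)"
    and chart_subset: "fst c \<subseteq> topspace X"
    and chart_homeomorphic:
      "homeomorphic_map (subtopology X (fst c)) (top_of_set (snd c ` fst c)) (snd c)"
    and chart_open_image: "open (snd c ` fst c)"
    and chart_inj: "inj_on (snd c) (fst c)"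
proof -
  have c: "is_chart X c" using mfd assms by (auto simp: smooth_manifold_def)
  then show "openin X (fst c)" "open (snd c ` fst c)"
    and h: "homeomorphic_map (subtopology X (fst c)) (top_of_set (snd c ` fst c)) (snd c)"
    by (auto simp: is_chart_def)
  then show s: "fst c \<subseteq> topspace X" by (simp add: openin_subset)
  show "inj_on (snd c) (fst c)"
    using homeomorphic_imp_injective_map[OF h] s by (simp add: Int_absorb1)
qed

lemma chart_inverse [simp]:
  "c \<in> A \<Longrightarrow> p \<in> fst c \<Longrightarrow> inv_into (fst c) (snd c) (snd c p) = p"
  by (simp add: chart_inj)

lemma charts_at_nonempty: "p \<in> topspace X \<Longrightarrow> \<exists>c. c \<in> charts_at A p"
  using mfd unfolding smooth_manifold_def charts_at_def by blast

lemma open_chart_image: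
  assumes "c \<in> A" "openin X U" "U \<subseteq> fst c"
  shows "open (snd c ` U)"
proof -
  have "openin (subtopology X (fst c)) U"
    using assms by (simp add: openin_subset_topspace_eq openin_open_subtopology chart_open)
  then have "openin (top_of_set (snd c ` fst c)) (snd c ` U)"
    using homeomorphic_imp_open_map[OF chart_homeomorphic[OF assms(1)]] by (simp add: open_map_def)
  then show ?thesis
    using chart_open_image[OF assms(1)] openin_open_trans by blast
qed

lemma openin_chart_vimage:
  assumes "c \<in> A" "open T"
  shows "openin X {q \<in> fst c. snd c q \<in> T}"
proof -
  have "continuous_map (subtopology X (fst c)) euclidean (snd c)"
    using homeomorphic_imp_continuous_map[OF chart_homeomorphic[OF assms(1)]]
    by (simp add: continuous_map_in_subtopology)
  from openin_continuous_map_preimage[OF this, of T]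
  have "openin (subtopology X (fst c)) {q \<in> fst c. snd c q \<in> T}"
    using assms(2) chart_subset[OF assms(1)] by (simp add: Int_absorb1)
  then show ?thesis
    using chart_open[OF assms(1)] openin_trans_full by blast
qed

lemma continuous_map_chart_inverse:
  assumes "c \<in> A"
  shows "continuous_map (top_of_set (snd c ` fst c)) X (inv_into (fst c) (snd c))"
  unfolding continuous_map_def
proof (intro conjI allI impI)
  show "inv_into (fst c) (snd c) \<in> topspace (top_of_set (snd c ` fst c)) \<rightarrow> topspace X"
    using chart_subset[OF assms] by (auto intro!: subsetD[OF _ inv_into_into])
  fix U assume U: "openin X U"
  have "{y \<in> topspace (top_of_set (snd c ` fst c)). inv_into (fst c) (snd c) y \<in> U}
      = snd c ` (fst c \<inter> U)"
    using assms by auto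
  moreover have "open (snd c ` (fst c \<inter> U))"
    using assms U chart_open[OF assms] by (intro open_chart_image) auto
  ultimately show "openin (top_of_set (snd c ` fst c))
      {y \<in> topspace (top_of_set (snd c ` fst c)). inv_into (fst c) (snd c) y \<in> U}"
    by (simp add: image_mono openin_open_eq chart_open_image[OF assms])
qed

section \<open>Local representatives and changes of charts\<close>

lemma coord_rep_apply:
  "c \<in> A \<Longrightarrow> p \<in> fst c \<Longrightarrow> coord_rep c d g (snd c p) = snd d (g p)"
  by (simp add: coord_rep_def)

lemma open_coord_dom:
  assumes "continuous_map X X g" "c \<in> A" "d \<in> A"
  shows "open (coord_dom c d g)"
proof -
  have eq: "{p \<in> fst c. g p \<in> fst d} = fst c \<inter> {p \<in> topspace X. g p \<in> fst d}"
    using chart_subset[OF assms(2)] by auto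
  have "openin X (fst c \<inter> {p \<in> topspace X. g p \<in> fst d})"
    by (rule openin_Int[OF chart_open[OF assms(2)]
          openin_continuous_map_preimage[OF assms(1) chart_open[OF assms(3)]]])
  then show ?thesis
    unfolding coord_dom_def eq by (rule open_chart_image[OF assms(2)]) simp
qed

lemma C1_near_coord_rep:
  assumes "C1_self_map X A g" "c \<in> charts_at A p" "d \<in> charts_at A (g p)"
  shows "C1_near (coord_rep c d g) (snd c p)"
proof -
  have "open (coord_dom c d g)" "Ck_on 1 (coord_dom c d g) (coord_rep c d g)"
    using assms open_coord_dom unfolding C1_self_map_def charts_at_iff by blast+
  moreover have "snd c p \<in> coord_dom c d g"
    using assms by (auto simp: coord_dom_def charts_at_iff)
  ultimately show ?thesis
    unfolding C1_near_def by blast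
qed

text \<open>The local representatives of \<open>id\<close> are the transition maps, so this is
  compatibility of the atlas at order 1.\<close>

lemma C1_self_map_id: "C1_self_map X A id"
  using mfd unfolding C1_self_map_def smooth_manifold_def by (metis continuous_map_id)

lemma C1_maps_iff:
  "g \<in> C1_maps X A \<longleftrightarrow> g \<in> extensional (topspace X) \<and> C1_self_map X A g"
  unfolding C1_maps_def C1_self_map_def PiE_def using continuous_map_funspace by blast

text \<open>Chain rule through an intermediate chart. The representative factors only on
  \<open>coord_dom c d g\<close>, since elsewhere the intermediate chart has no meaningful value; as
  this set is open, regularity and derivative at the point are unaffected.\<close>

lemma coord_rep_comp:
  assumes "continuous_map X X g" "c \<in> charts_at A p" "d \<in> charts_at A (g p)" "e \<in> A"
    and "C1_near (coord_rep c d g) (snd c p)" "C1_near (coord_rep d e k) (snd d (g p))"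
  shows C1_near_coord_rep_comp: "C1_near (coord_rep c e (k \<circ> g)) (snd c p)"
    and fderiv_coord_rep_comp: "fderiv (coord_rep c e (k \<circ> g)) (snd c p) =
      fderiv (coord_rep d e k) (snd d (g p)) o\<^sub>L fderiv (coord_rep c d g) (snd c p)"
proof -
  have A: "c \<in> A" "d \<in> A" "p \<in> fst c" "g p \<in> fst d"
    using assms by (auto simp: charts_at_iff)
  have p: "coord_rep c d g (snd c p) = snd d (g p)"
    using A by (simp add: coord_rep_apply)
  have eq: "coord_rep c e (k \<circ> g) y = coord_rep d e k (coord_rep c d g y)"
    if "y \<in> coord_dom c d g" for y
    using that A by (auto simp: coord_rep_def coord_dom_def)
  have T: "open (coord_dom c d g)" "snd c p \<in> coord_dom c d g"
    using A open_coord_dom[OF assms(1)] by (auto simp: coord_dom_def)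
  have C: "C1_near (\<lambda>y. coord_rep d e k (coord_rep c d g y)) (snd c p)"
    using C1_near_compose[of "coord_rep c d g" "snd c p" "coord_rep d e k"] assms(5,6)
    unfolding p by blast
  then show "C1_near (coord_rep c e (k \<circ> g)) (snd c p)"
    by (rule C1_near_transform_open[OF _ T eq])
  have "fderiv (coord_rep c e (k \<circ> g)) (snd c p)
      = fderiv (\<lambda>y. coord_rep d e k (coord_rep c d g y)) (snd c p)"
    unfolding fderiv_def
    using frechet_derivative_transform_open[OF C1_near_differentiable[OF C] T eq] by simp
  also have "\<dots> = fderiv (coord_rep d e k) (snd d (g p)) o\<^sub>L fderiv (coord_rep c d g) (snd c p)"
    using fderiv_compose[of "coord_rep c d g" "snd c p" "coord_rep d e k"]
      assms(5,6)[THEN C1_near_differentiable]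
    unfolding p by blast
  finally show "fderiv (coord_rep c e (k \<circ> g)) (snd c p) =
      fderiv (coord_rep d e k) (snd d (g p)) o\<^sub>L fderiv (coord_rep c d g) (snd c p)" .
qed

text \<open>The chain rule is used twice with the identity as one factor: first to change the source
  chart (\<open>g \<circ> id\<close>), then the target chart (\<open>id \<circ> g\<close>).\<close>

lemma
  assumes "continuous_map X X g" "c \<in> charts_at A p" "c' \<in> charts_at A p"
    and "d \<in> charts_at A (g p)" "d' \<in> charts_at A (g p)"
    and "C1_near (coord_rep c d g) (snd c p)"
  shows C1_near_change_charts: "C1_near (coord_rep c' d' g) (snd c' p)"
    and fderiv_change_charts: "fderiv (coord_rep c' d' g) (snd c' p) =
      fderiv (coord_rep d d' id) (snd d (g p)) o\<^sub>L
        (fderiv (coord_rep c d g) (snd c p) o\<^sub>L fderiv (coord_rep c' c id) (snd c' p))"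
proof -
  have A: "d \<in> A" "d' \<in> A" using assms by (auto simp: charts_at_iff)
  have 1: "C1_near (coord_rep c' c id) (snd c' p)"
    by (rule C1_near_coord_rep[OF C1_self_map_id]) (use assms in auto)
  have 2: "C1_near (coord_rep d d' id) (snd d (g p))"
    by (rule C1_near_coord_rep[OF C1_self_map_id]) (use assms in auto)
  have "continuous_map X X id" "c \<in> charts_at A (id p)" "C1_near (coord_rep c d g) (snd c (id p))"
    using assms by auto
  note 3 = coord_rep_comp[OF this(1) assms(3) this(2) A(1) 1 this(3), simplified comp_id]
  note 4 = coord_rep_comp[OF assms(1) assms(3,4) A(2) 3(1) 2, simplified id_comp]
  show "C1_near (coord_rep c' d' g) (snd c' p)"
    by (rule 4(1))
  show "fderiv (coord_rep c' d' g) (snd c' p) =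
      fderiv (coord_rep d d' id) (snd d (g p)) o\<^sub>L
        (fderiv (coord_rep c d g) (snd c p) o\<^sub>L fderiv (coord_rep c' c id) (snd c' p))"
    by (simp add: 4(2) 3(2) id_def)
qed

text \<open>One pair of charts at each point is enough, because regularity survives the change to
  any other pair.\<close>

lemma C1_self_mapI:
  assumes "continuous_map X X g"
    and "\<And>p. p \<in> topspace X \<Longrightarrow> \<exists>c\<in>charts_at A p. \<exists>d\<in>charts_at A (g p).
           C1_near (coord_rep c d g) (snd c p)"
  shows "C1_self_map X A g"
  unfolding C1_self_map_def
proof (intro conjI ballI)
  fix c d assume cd: "c \<in> A" "d \<in> A"
  have "C1_near (coord_rep c d g) y" if y: "y \<in> coord_dom c d g" for y
  proof -
    obtain p where p: "y = snd c p" "p \<in> fst c" "g p \<in> fst d"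
      using y by (auto simp: coord_dom_def)
    with cd have "c \<in> charts_at A p" "d \<in> charts_at A (g p)" "p \<in> topspace X"
      using chart_subset[OF cd(1)] by (auto simp: charts_at_iff)
    moreover from this(3) obtain c' d' where "c' \<in> charts_at A p" "d' \<in> charts_at A (g p)"
      "C1_near (coord_rep c' d' g) (snd c' p)"
      using assms(2) by blast
    ultimately show ?thesis
      unfolding p(1) using C1_near_change_charts[OF assms(1)] by blast
  qed
  then show "Ck_on 1 (coord_dom c d g) (coord_rep c d g)"
    using Ck_on_1_iff_C1_near open_coord_dom[OF assms(1) cd] by blast
qed (fact assms(1))

section \<open>Tangent spaces\<close>

lemma frechet_derivative_coord_rep:
  assumes "C1_self_map X A g" "c \<in> charts_at A p" "d \<in> charts_at A (g p)"
  shows "frechet_derivative (coord_rep c d g) (at (snd c p)) =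
    blinfun_apply (fderiv (coord_rep c d g) (snd c p))"
  using C1_near_coord_rep[OF assms] by (simp add: fderiv_apply C1_near_differentiable)

lemma tangent_space_iff:
  "\<xi> \<in> tangent_space A p \<longleftrightarrow> \<xi> \<in> extensional (charts_at A p) \<and>
     (\<forall>c\<in>charts_at A p. \<forall>d\<in>charts_at A p. \<xi> d = fderiv (coord_rep c d id) (snd c p) (\<xi> c))"
  by (auto simp: tangent_space_def frechet_derivative_coord_rep[OF C1_self_map_id] PiE_def)

lemma fderiv_coord_rep_id_self:
  assumes "c \<in> charts_at A p"
  shows "fderiv (coord_rep c c id) (snd c p) = id_blinfun"
proof (rule fderiv_eqI)
  have c: "c \<in> A" "p \<in> fst c" using assms by (auto simp: charts_at_iff)
  have "((\<lambda>y. y) has_derivative blinfun_apply id_blinfun) (at (snd c p))"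
    by (simp add: id_blinfun.rep_eq)
  then show "(coord_rep c c id has_derivative blinfun_apply id_blinfun) (at (snd c p))"
    by (rule has_derivative_transform_within_open[OF _ chart_open_image[OF c(1)]])
      (use c in \<open>auto simp: coord_rep_apply\<close>)
qed

lemma fderiv_coord_rep_id_trans:
  assumes "c \<in> charts_at A p" "d \<in> charts_at A p" "e \<in> charts_at A p"
  shows "fderiv (coord_rep d e id) (snd d p) (fderiv (coord_rep c d id) (snd c p) v) =
    fderiv (coord_rep c e id) (snd c p) v"
proof -
  have "C1_near (coord_rep c d id) (snd c p)" "C1_near (coord_rep d e id) (snd d p)"
    using assms by (auto intro!: C1_near_coord_rep C1_self_map_id)
  then have "fderiv (coord_rep c e (id \<circ> id)) (snd c p) =
      fderiv (coord_rep d e id) (snd d (id p)) o\<^sub>L fderiv (coord_rep c d id) (snd c p)"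
    using assms by (intro fderiv_coord_rep_comp) (auto simp: charts_at_iff)
  then show ?thesis
    by simp
qed

text \<open>A tangent vector is determined by its entry in one chart, and any vector occurs as that
  entry: transporting it by transition derivatives gives a compatible family by the cocycle
  identity.\<close>

lemma bij_betw_tangent_space:
  assumes "c \<in> charts_at A p"
  shows "bij_betw (\<lambda>\<xi>. \<xi> c) (tangent_space A p) UNIV"
proof (rule bij_betw_byWitness[where
      f' = "\<lambda>v. \<lambda>d\<in>charts_at A p. fderiv (coord_rep c d id) (snd c p) v"])
  show "\<forall>\<xi>\<in>tangent_space A p.
      (\<lambda>d\<in>charts_at A p. fderiv (coord_rep c d id) (snd c p) (\<xi> c)) = \<xi>"
  proof
    fix \<xi> assume "\<xi> \<in> tangent_space A p"
    then have ext: "\<xi> \<in> extensional (charts_at A p)"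
      and "\<forall>d\<in>charts_at A p. \<xi> d = fderiv (coord_rep c d id) (snd c p) (\<xi> c)"
      using assms unfolding tangent_space_iff by blast+
    then have eq: "fderiv (coord_rep c d id) (snd c p) (\<xi> c) = \<xi> d" if "d \<in> charts_at A p" for d
      using that by simp
    show "(\<lambda>d\<in>charts_at A p. fderiv (coord_rep c d id) (snd c p) (\<xi> c)) = \<xi>"
      by (rule extensionalityI[OF restrict_extensional ext]) (simp add: eq)
  qed
  show "\<forall>v\<in>UNIV. (\<lambda>d\<in>charts_at A p. fderiv (coord_rep c d id) (snd c p) v) c = v"
    using assms by (simp add: fderiv_coord_rep_id_self)
  show "(\<lambda>v. \<lambda>d\<in>charts_at A p. fderiv (coord_rep c d id) (snd c p) v) ` UNIV \<subseteq> tangent_space A p"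
    using assms by (auto simp: tangent_space_iff fderiv_coord_rep_id_trans)
qed auto

text \<open>Frees the tangent map from the chart selected by \<open>SOME\<close> in its definition;
  the chain rule and the transformation law of \<open>\<xi>\<close> compensate each other.\<close>

lemma tangent_map_in_charts:
  assumes "C1_self_map X A g" "c \<in> charts_at A p" "d \<in> charts_at A (g p)" "\<xi> \<in> tangent_space A p"
  shows "tangent_map A g p \<xi> d = fderiv (coord_rep c d g) (snd c p) (\<xi> c)"
proof -
  define c' where "c' = (SOME c. c \<in> charts_at A p)"
  have c': "c' \<in> charts_at A p"
    unfolding c'_def using assms(2) by (rule someI)
  have "fderiv (coord_rep c' d (g \<circ> id)) (snd c' p) =
      fderiv (coord_rep c d g) (snd c (id p)) o\<^sub>L fderiv (coord_rep c' c id) (snd c' p)"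
    using assms(1-3) c'
    by (intro fderiv_coord_rep_comp)
      (auto simp: charts_at_iff intro!: C1_near_coord_rep C1_self_map_id)
  then have "fderiv (coord_rep c' d g) (snd c' p) =
      fderiv (coord_rep c d g) (snd c p) o\<^sub>L fderiv (coord_rep c' c id) (snd c' p)"
    by (simp add: id_def o_def)
  moreover have "\<xi> c = fderiv (coord_rep c' c id) (snd c' p) (\<xi> c')"
    using assms(2,4) c' by (metis tangent_space_iff)
  moreover have "tangent_map A g p \<xi> d = fderiv (coord_rep c' d g) (snd c' p) (\<xi> c')"
    using assms(3) frechet_derivative_coord_rep[OF assms(1) c' assms(3)]
    by (simp add: tangent_map_def c'_def[symmetric])
  ultimately show ?thesis
    by simp
qed

lemma tangent_map_in_tangent_space:
  assumes "C1_self_map X A g" "p \<in> topspace X" "\<xi> \<in> tangent_space A p"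
  shows "tangent_map A g p \<xi> \<in> tangent_space A (g p)"
  unfolding tangent_space_iff
proof (intro conjI ballI)
  show "tangent_map A g p \<xi> \<in> extensional (charts_at A (g p))"
    by (simp add: tangent_map_def Let_def)
  fix d e assume de: "d \<in> charts_at A (g p)" "e \<in> charts_at A (g p)"
  obtain c where c: "c \<in> charts_at A p"
    using assms charts_at_nonempty by blast
  have "fderiv (coord_rep c e g) (snd c p) =
      fderiv (coord_rep d e id) (snd d (g p)) o\<^sub>L fderiv (coord_rep c d g) (snd c p)"
    using fderiv_coord_rep_comp[of g c p d e id] C1_self_map_continuous[OF assms(1)]
      C1_near_coord_rep[OF assms(1) c de(1)] C1_near_coord_rep[OF C1_self_map_id, of d "g p" e] c de
    by (simp add: charts_at_iff)
  then show "tangent_map A g p \<xi> e =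
      fderiv (coord_rep d e id) (snd d (g p)) (tangent_map A g p \<xi> d)"
    using assms c de by (simp add: tangent_map_in_charts[of g c])
qed

text \<open>Evaluation in \<open>c\<close> and in \<open>d\<close> identifies the two tangent spaces
  with the model space and turns the tangent map into the derivative of the local representative, so
  criticality can be read off in any one pair of charts.\<close>

lemma critical_set_iff:
  assumes "C1_self_map X A g" "c \<in> charts_at A p" "d \<in> charts_at A (g p)"
  shows "p \<in> critical_set X A g \<longleftrightarrow> \<not> bij (blinfun_apply (fderiv (coord_rep c d g) (snd c p)))"
proof -
  have p: "p \<in> topspace X"
    using assms(2) chart_subset[of c] by (auto simp: charts_at_iff)
  let ?T = "tangent_map A g p" and ?D = "blinfun_apply (fderiv (coord_rep c d g) (snd c p))"
  have T: "?T ` tangent_space A p \<subseteq> tangent_space A (g p)"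
    using tangent_map_in_tangent_space[OF assms(1) p] by blast
  have "bij_betw ?T (tangent_space A p) (tangent_space A (g p)) \<longleftrightarrow>
      bij_betw ((\<lambda>\<xi>. \<xi> d) \<circ> ?T) (tangent_space A p) UNIV"
    by (rule bij_betw_comp_iff2[OF bij_betw_tangent_space[OF assms(3)] T])
  also have "\<dots> \<longleftrightarrow> bij_betw (?D \<circ> (\<lambda>\<xi>. \<xi> c)) (tangent_space A p) UNIV"
    by (rule bij_betw_cong) (simp add: tangent_map_in_charts[OF assms])
  also have "\<dots> \<longleftrightarrow> bij ?D"
    by (rule bij_betw_comp_iff[OF bij_betw_tangent_space[OF assms(2)], symmetric])
  finally show ?thesis using p by (simp add: critical_set_def)
qed

end

section \<open>The perturbation\<close>

text \<open>The last assumption is where non-convexity of chart images is dealt with: for small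
  radii the interpolated values stay in the image of \<open>d\<close>, so that they can be pulled
  back to the manifold.\<close>

locale flattening = manifold X A for X :: "'a topology" and A :: "('a, 'e::euclidean_space) chart set" +
  fixes f :: "'a \<Rightarrow> 'a" and p :: 'a and c d :: "('a, 'e) chart" and \<delta> :: real
  assumes f: "f \<in> C1_maps X A"
    and c: "c \<in> charts_at A p" and d: "d \<in> charts_at A (f p)"
    and delta_pos: "\<delta> > 0"
    and ball_delta: "ball (snd c p) \<delta> \<subseteq> coord_dom c d f"
    and linearize_in_chart:
      "\<And>r x. 0 < r \<Longrightarrow> r < \<delta> \<Longrightarrow> x \<in> ball (snd c p) \<delta> \<Longrightarrow>
         linearize (coord_rep c d f) (snd c p) r x \<in> snd d ` fst d"
begin

abbreviation F :: "'e \<Rightarrow> 'e" where "F \<equiv> coord_rep c d f"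
abbreviation a :: 'e where "a \<equiv> snd c p"
abbreviation W :: "'a set" where "W \<equiv> {q \<in> fst c. snd c q \<in> ball a \<delta>}"
abbreviation K :: "real \<Rightarrow> 'a set" where "K r \<equiv> {q \<in> fst c. snd c q \<in> cball a (2 * r)}"

definition flat :: "real \<Rightarrow> 'a \<Rightarrow> 'a" where
  "flat r q = (if q \<in> W then inv_into (fst d) (snd d) (linearize F a r (snd c q)) else f q)"

lemma cA: "c \<in> A" and dA: "d \<in> A" and p_c: "p \<in> fst c" and fp_d: "f p \<in> fst d"
  using c d by (auto simp: charts_at_iff)

lemma C1_f: "C1_self_map X A f" and f_ext: "f \<in> extensional (topspace X)"
  using f by (auto simp: C1_maps_iff)

lemma F_a: "F a = snd d (f p)"
  by (simp add: coord_rep_apply cA p_c)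

lemma f_W: "q \<in> W \<Longrightarrow> f q \<in> fst d"
proof -
  assume q: "q \<in> W"
  then have "snd c q \<in> snd c ` {q \<in> fst c. f q \<in> fst d}"
    using ball_delta unfolding coord_dom_def by blast
  then obtain q' where "q' \<in> fst c" "f q' \<in> fst d" "snd c q = snd c q'"
    by blast
  then show ?thesis
    using q chart_inj[OF cA] by (auto dest: inj_onD)
qed

lemma C1_near_F: "x \<in> ball a \<delta> \<Longrightarrow> C1_near F x"
proof -
  assume x: "x \<in> ball a \<delta>"
  have "Ck_on 1 (coord_dom c d f) F"
    using C1_f cA dA unfolding C1_self_map_def by blast
  then show ?thesis
    using x ball_delta open_coord_dom[OF C1_self_map_continuous[OF C1_f] cA dA]
    unfolding C1_near_def by blast
qed

section \<open>Gluing the linearized map to the original one\<close>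

context
  fixes r :: real
  assumes r_pos: "r > 0" and r_less: "2 * r < \<delta>"
begin

lemma
  assumes "q \<in> W"
  shows flat_W: "flat r q \<in> fst d"
    and flat_chart: "snd d (flat r q) = linearize F a r (snd c q)"
proof -
  have "linearize F a r (snd c q) \<in> snd d ` fst d"
    using assms r_pos r_less by (intro linearize_in_chart) auto
  then show "flat r q \<in> fst d" "snd d (flat r q) = linearize F a r (snd c q)"
    using assms by (simp_all add: flat_def inv_into_into f_inv_into_f)
qed

lemma flat_off:
  assumes "q \<notin> K r"
  shows "flat r q = f q"
proof (cases "q \<in> W")
  case True
  then have "2 * r \<le> dist (snd c q) a"
    using assms by (auto simp: dist_commute)
  then have "flat r q = inv_into (fst d) (snd d) (F (snd c q))"
    using True r_pos by (simp add: flat_def linearize_far)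
  also have "F (snd c q) = snd d (f q)"
    using True cA by (simp add: coord_rep_apply)
  finally show ?thesis
    using True f_W dA by simp
qed (auto simp: flat_def)

lemma openin_W: "openin X W"
  by (rule openin_chart_vimage[OF cA open_ball])

text \<open>\<open>K r\<close> has to be closed in the whole space and not merely in the chart
  domain. It is compact, as the image of a closed ball under the inverse chart, and the space is
  Hausdorff.\<close>

lemma openin_off_K: "openin X (topspace X - K r)"
proof -
  have sub: "cball a (2 * r) \<subseteq> snd c ` fst c"
  proof
    fix x assume "x \<in> cball a (2 * r)"
    then have "x \<in> coord_dom c d f"
      using ball_delta r_less by auto
    then show "x \<in> snd c ` fst c"
      by (auto simp: coord_dom_def)
  qed
  have "compactin (top_of_set (snd c ` fst c)) (cball a (2 * r))"
    using sub by (simp add: compactin_subtopology)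
  from image_compactin[OF this continuous_map_chart_inverse[OF cA]]
  have "compactin X (inv_into (fst c) (snd c) ` cball a (2 * r))" .
  moreover have "inv_into (fst c) (snd c) ` cball a (2 * r) = K r"
  proof (intro equalityI subsetI)
    fix q assume "q \<in> inv_into (fst c) (snd c) ` cball a (2 * r)"
    then obtain x where "x \<in> cball a (2 * r)" "q = inv_into (fst c) (snd c) x" by blast
    with sub show "q \<in> K r" by (auto simp: inv_into_into f_inv_into_f)
  next
    fix q assume "q \<in> K r"
    then show "q \<in> inv_into (fst c) (snd c) ` cball a (2 * r)"
      by (intro image_eqI[of _ _ "snd c q"]) (simp_all add: cA)
  qed
  moreover have "Hausdorff_space X"
    using mfd by (simp add: smooth_manifold_def)
  ultimately have "closedin X (K r)"
    using compactin_imp_closedin by metis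
  then show ?thesis by blast
qed

lemma off_K_or_W: "q \<in> topspace X \<Longrightarrow> q \<in> topspace X - K r \<or> q \<in> W"
  using r_less by auto

text \<open>Pasting over two open sets: \<open>W\<close>, where the map is the linearization read in
  charts, and the complement of \<open>K r\<close>, where it is \<open>f\<close>. They cover the
  space because \<open>2 * r < \<delta>\<close>.\<close>

lemma continuous_map_flat: "continuous_map X X (flat r)"
proof -
  let ?T = "\<lambda>b. if b then W else topspace X - K r"
  have 1: "continuous_map (subtopology X W) X (flat r)"
  proof -
    have "continuous_map (subtopology X W) (top_of_set (ball a \<delta>)) (snd c)"
    proof -
      have "continuous_map (subtopology X (fst c)) euclidean (snd c)"
        using homeomorphic_imp_continuous_map[OF chart_homeomorphic[OF cA]]
        by (simp add: continuous_map_in_subtopology)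
      then have "continuous_map (subtopology X W) euclidean (snd c)"
        by (rule continuous_map_from_subtopology_mono) auto
      then show ?thesis
        by (auto simp: continuous_map_in_subtopology)
    qed
    moreover have "continuous_map (top_of_set (ball a \<delta>)) (top_of_set (snd d ` fst d)) (linearize F a r)"
    proof -
      have "isCont (linearize F a r) x" if "x \<in> ball a \<delta>" for x
        using C1_near_differentiable[OF C1_near_linearize[OF C1_near_F[OF that] r_pos]]
        by (rule differentiable_imp_continuous_within)
      then have "continuous_on (ball a \<delta>) (linearize F a r)"
        by (intro continuous_at_imp_continuous_on) blast
      moreover have "linearize F a r x \<in> snd d ` fst d" if "x \<in> ball a \<delta>" for x
        using r_pos r_less that by (intro linearize_in_chart) auto
      ultimately show ?thesis
        by (simp add: continuous_map_in_subtopology image_subset_iff)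
    qed
    ultimately have "continuous_map (subtopology X W) X
        (inv_into (fst d) (snd d) \<circ> (linearize F a r \<circ> snd c))"
      using continuous_map_chart_inverse[OF dA] by (intro continuous_map_compose)
    then show ?thesis
      by (rule continuous_map_eq) (simp add: flat_def)
  qed
  have 2: "continuous_map (subtopology X (topspace X - K r)) X (flat r)"
    by (rule continuous_map_eq[OF continuous_map_from_subtopology[OF C1_self_map_continuous[OF C1_f]]])
      (metis DiffE IntE flat_off topspace_subtopology)
  show ?thesis
  proof (rule pasting_lemma[where I = UNIV and T = ?T and f = "\<lambda>_. flat r"])
    show "openin X (?T b)" "continuous_map (subtopology X (?T b)) X (flat r)" for b
      using 1 2 openin_W openin_off_K by (cases b; simp only: if_True if_False)+
    show "\<exists>b. b \<in> UNIV \<and> q \<in> ?T b \<and> flat r q = flat r q" if "q \<in> topspace X" for q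
      using off_K_or_W[OF that]
    proof
      assume "q \<in> W"
      then show ?thesis by (intro exI[of _ True]) (simp only: if_True UNIV_I)
    next
      assume "q \<in> topspace X - K r"
      then show ?thesis by (intro exI[of _ False]) (simp only: if_False UNIV_I)
    qed
  qed (rule refl)
qed

lemma coord_rep_flat: "x \<in> ball a \<delta> \<Longrightarrow> coord_rep c d (flat r) x = linearize F a r x"
proof -
  assume x: "x \<in> ball a \<delta>"
  then have "x \<in> coord_dom c d f"
    using ball_delta by blast
  then obtain q where q: "q \<in> fst c" "x = snd c q"
    unfolding coord_dom_def by blast
  then have "q \<in> W"
    using x by blast
  then show ?thesis
    unfolding q(2) coord_rep_apply[OF cA q(1)] by (rule flat_chart)
qed

lemma
  assumes "x \<in> ball a \<delta>"
  shows C1_near_coord_rep_flat: "C1_near (coord_rep c d (flat r)) x"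
    and fderiv_coord_rep_flat: "fderiv (coord_rep c d (flat r)) x = fderiv (linearize F a r) x"
proof -
  have near: "C1_near (linearize F a r) x"
    using C1_near_linearize C1_near_F assms r_pos by blast
  then show "C1_near (coord_rep c d (flat r)) x"
    by (rule C1_near_transform_open[OF _ open_ball assms coord_rep_flat])
  show "fderiv (coord_rep c d (flat r)) x = fderiv (linearize F a r) x"
    using frechet_derivative_transform_open[OF C1_near_differentiable[OF near] open_ball assms
        coord_rep_flat]
    by (simp add: fderiv_def)
qed

lemma
  assumes q: "q \<in> topspace X - K r" and c': "c' \<in> charts_at A q" and d': "d' \<in> charts_at A (f q)"
  shows C1_near_coord_rep_flat_off: "C1_near (coord_rep c' d' (flat r)) (snd c' q)"
    and fderiv_coord_rep_flat_off:
      "fderiv (coord_rep c' d' (flat r)) (snd c' q) = fderiv (coord_rep c' d' f) (snd c' q)"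
proof -
  have A': "c' \<in> A" "q \<in> fst c'" using c' by (auto simp: charts_at_iff)
  define T where "T = snd c' ` (fst c' \<inter> (topspace X - K r))"
  have T: "open T"
    unfolding T_def
    by (rule open_chart_image[OF A'(1) openin_Int[OF chart_open[OF A'(1)] openin_off_K]]) blast
  have qT: "snd c' q \<in> T" using A' q by (auto simp: T_def)
  have eq: "coord_rep c' d' (flat r) y = coord_rep c' d' f y" if "y \<in> T" for y
  proof -
    obtain q' where "y = snd c' q'" "q' \<in> fst c' \<inter> (topspace X - K r)"
      using \<open>y \<in> T\<close> unfolding T_def by (rule imageE)
    then have q': "y = snd c' q'" "q' \<in> fst c'" "q' \<notin> K r"
      by simp_all
    show ?thesis
      unfolding q'(1) coord_rep_apply[OF A'(1) q'(2)] flat_off[OF q'(3)] by (rule refl)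
  qed
  have near: "C1_near (coord_rep c' d' f) (snd c' q)"
    by (rule C1_near_coord_rep[OF C1_f c' d'])
  then show "C1_near (coord_rep c' d' (flat r)) (snd c' q)"
    by (rule C1_near_transform_open[OF _ T qT eq])
  show "fderiv (coord_rep c' d' (flat r)) (snd c' q) = fderiv (coord_rep c' d' f) (snd c' q)"
    using frechet_derivative_transform_open[OF C1_near_differentiable[OF near] T qT eq]
    by (simp add: fderiv_def)
qed

lemma C1_self_map_flat: "C1_self_map X A (flat r)"
proof (rule C1_self_mapI[OF continuous_map_flat])
  fix q assume q: "q \<in> topspace X"
  from off_K_or_W[OF q]
  show "\<exists>c\<in>charts_at A q. \<exists>d\<in>charts_at A (flat r q). C1_near (coord_rep c d (flat r)) (snd c q)"
  proof
    assume off: "q \<in> topspace X - K r"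
    have "f q \<in> topspace X"
      using continuous_map_funspace[OF C1_self_map_continuous[OF C1_f]] q by blast
    then obtain c' d' where "c' \<in> charts_at A q" "d' \<in> charts_at A (f q)"
      using charts_at_nonempty q by metis
    moreover have "flat r q = f q"
      using off flat_off by blast
    ultimately show ?thesis
      using C1_near_coord_rep_flat_off[OF off] by metis
  next
    assume W: "q \<in> W"
    then have "c \<in> charts_at A q" "d \<in> charts_at A (flat r q)"
      using cA dA flat_W by (auto simp: charts_at_iff)
    then show ?thesis
      using C1_near_coord_rep_flat W by blast
  qed
qed

lemma flat_in_C1_maps: "flat r \<in> C1_maps X A"
proof -
  \<comment> \<open>Such a point lies in no chart domain, so the second branch of
    \<open>flat\<close> applies and inherits extensionality from \<open>f\<close>.\<close>
  have "flat r q = undefined" if "q \<notin> topspace X" for q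
    using that chart_subset[OF cA] f_ext by (auto simp: flat_def extensional_def)
  then show ?thesis
    unfolding C1_maps_iff using C1_self_map_flat by (simp add: extensional_def)
qed

lemma ball_subset_critical_set:
  assumes "p \<in> critical_set X A f"
  shows "{q \<in> fst c. snd c q \<in> ball a r} \<subseteq> critical_set X A (flat r)"
proof
  fix q assume q: "q \<in> {q \<in> fst c. snd c q \<in> ball a r}"
  then have W: "q \<in> W" using r_pos r_less by auto
  have "((\<lambda>x. F a + fderiv F a (x - a)) has_derivative blinfun_apply (fderiv F a)) (at (snd c q))"
    by (auto intro!: derivative_eq_intros)
  then have "(linearize F a r has_derivative blinfun_apply (fderiv F a)) (at (snd c q))"
    by (rule has_derivative_transform_within_open[of _ _ _ _ "ball a r"])
      (use q r_pos in \<open>auto simp: linearize_near dist_commute\<close>)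
  then have "fderiv (coord_rep c d (flat r)) (snd c q) = fderiv F a"
    using fderiv_coord_rep_flat W fderiv_eqI by simp
  moreover have "\<not> bij (blinfun_apply (fderiv F a))"
    using critical_set_iff[OF C1_f c d] assms by blast
  moreover have "c \<in> charts_at A q" "d \<in> charts_at A (flat r q)"
    using W cA dA flat_W by (auto simp: charts_at_iff)
  ultimately show "q \<in> critical_set X A (flat r)"
    using critical_set_iff[OF C1_self_map_flat] by metis
qed

end

section \<open>Convergence of the flattened maps in the C^1 topology\<close>

lemma C1_subbasic_iff:
  assumes "f\<^sub>0 \<in> C1_maps X A" "c' \<in> A" "d' \<in> A" "L \<subseteq> fst c'" "f\<^sub>0 ` L \<subseteq> fst d'"
  shows "g \<in> C1_subbasic X A f\<^sub>0 c' d' L \<epsilon> \<longleftrightarrow> g \<in> C1_maps X A \<and>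
    (\<forall>q\<in>L. g q \<in> fst d' \<and> norm (snd d' (g q) - snd d' (f\<^sub>0 q)) < \<epsilon> \<and>
      norm (fderiv (coord_rep c' d' g) (snd c' q) - fderiv (coord_rep c' d' f\<^sub>0) (snd c' q)) < \<epsilon>)"
proof (cases "g \<in> C1_maps X A \<and> g ` L \<subseteq> fst d'")
  case True
  \<comment> \<open>Once g maps \<open>L\<close> into the target chart, both representatives are
    differentiable at the points considered, and \<open>onorm\<close> becomes the norm of a
    difference of bounded operators.\<close>
  have norms: "norm (coord_rep c' d' g (snd c' q) - coord_rep c' d' f\<^sub>0 (snd c' q)) =
      norm (snd d' (g q) - snd d' (f\<^sub>0 q))"
    "onorm (\<lambda>v. frechet_derivative (coord_rep c' d' g) (at (snd c' q)) v -
        frechet_derivative (coord_rep c' d' f\<^sub>0) (at (snd c' q)) v) =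
      norm (fderiv (coord_rep c' d' g) (snd c' q) - fderiv (coord_rep c' d' f\<^sub>0) (snd c' q))"
    if "q \<in> L" for q
  proof -
    have q: "c' \<in> charts_at A q" "d' \<in> charts_at A (g q)" "d' \<in> charts_at A (f\<^sub>0 q)"
      using that assms True by (auto simp: charts_at_iff)
    then show "norm (coord_rep c' d' g (snd c' q) - coord_rep c' d' f\<^sub>0 (snd c' q)) =
        norm (snd d' (g q) - snd d' (f\<^sub>0 q))"
      by (simp add: coord_rep_apply charts_at_iff)
    have "C1_near (coord_rep c' d' g) (snd c' q)" "C1_near (coord_rep c' d' f\<^sub>0) (snd c' q)"
      using q True assms(1) by (auto simp: C1_maps_iff intro: C1_near_coord_rep)
    then show "onorm (\<lambda>v. frechet_derivative (coord_rep c' d' g) (at (snd c' q)) v -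
        frechet_derivative (coord_rep c' d' f\<^sub>0) (at (snd c' q)) v) =
      norm (fderiv (coord_rep c' d' g) (snd c' q) - fderiv (coord_rep c' d' f\<^sub>0) (snd c' q))"
      by (intro onorm_frechet_derivative_diff C1_near_differentiable)
  qed
  show ?thesis
    unfolding C1_subbasic_def using True by (simp add: norms image_subset_iff)
next
  case False
  then show ?thesis
    unfolding C1_subbasic_def by blast
qed

text \<open>The maps \<open>flat r\<close> and \<open>f\<close> differ only on \<open>K r\<close>, which shrinks to \<open>p\<close>. Hence the estimates
  defining a subbasic set need only be checked in the limit at the single point \<open>p\<close>, and no
  uniformity over the compact set is required.\<close>

lemma eventually_flat_close_at_p:
  assumes f\<^sub>0: "f\<^sub>0 \<in> C1_maps X A" and c': "c' \<in> charts_at A p"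
    and d': "d' \<in> charts_at A (f p)" "d' \<in> charts_at A (f\<^sub>0 p)"
    and close0: "norm (snd d' (f p) - snd d' (f\<^sub>0 p)) < \<epsilon>"
    and close1: "norm (fderiv (coord_rep c' d' f) (snd c' p) - fderiv (coord_rep c' d' f\<^sub>0) (snd c' p)) < \<epsilon>"
  shows "eventually (\<lambda>(r, x). \<forall>q\<in>fst c. snd c q = x \<longrightarrow> flat r q \<in> fst d' \<and>
      norm (snd d' (flat r q) - snd d' (f\<^sub>0 q)) < \<epsilon> \<and>
      norm (fderiv (coord_rep c' d' (flat r)) (snd c' q) - fderiv (coord_rep c' d' f\<^sub>0) (snd c' q)) < \<epsilon>)
    (at_right 0 \<times>\<^sub>F nhds a)" (is "eventually _ ?\<F>")
proof -
  let ?x = "\<lambda>z :: real \<times> 'e. snd z" and ?y = "\<lambda>z. linearize F a (fst z) (snd z)"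
  let ?\<sigma> = "coord_rep c c' id" and ?\<sigma>' = "coord_rep c' c id" and ?\<tau> = "coord_rep d d' id"
    and ?D\<^sub>0 = "fderiv (coord_rep c' d' f\<^sub>0)"
  have A': "c' \<in> A" "d' \<in> A" "p \<in> fst c'" "f p \<in> fst d'" "f\<^sub>0 p \<in> fst d'"
    using c' d' by (auto simp: charts_at_iff)
  have C1_f0: "C1_self_map X A f\<^sub>0" using f\<^sub>0 by (simp add: C1_maps_iff)
  have x: "(?x \<longlongrightarrow> a) ?\<F>" by (rule filterlim_snd)
  have Fa: "isCont F a"
    using C1_near_F delta_pos C1_near_differentiable differentiable_imp_continuous_within
    by (metis centre_in_ball)
  have y: "(?y \<longlongrightarrow> F a) ?\<F>"
    using tendsto_linearize[OF Fa] by (simp add: case_prod_beta')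
  have y': "((\<lambda>z. fderiv (linearize F a (fst z)) (snd z)) \<longlongrightarrow> fderiv F a) ?\<F>"
    using tendsto_fderiv_linearize[OF C1_near_F] delta_pos by (simp add: case_prod_beta')
  have s: "C1_near ?\<sigma> a" "C1_near ?\<sigma>' (snd c' p)" "C1_near ?\<tau> (F a)"
    "C1_near (coord_rep c d' f\<^sub>0) a" "C1_near (coord_rep c' d' f\<^sub>0) (snd c' p)"
    unfolding F_a using c c' d d' C1_f0 C1_self_map_id by (auto intro!: C1_near_coord_rep)
  have cont: "isCont G z" if "C1_near G z" for G :: "'e \<Rightarrow> 'e" and z
    using that C1_near_differentiable differentiable_imp_continuous_within by blast
  have sx: "((\<lambda>z. ?\<sigma> (?x z)) \<longlongrightarrow> snd c' p) ?\<F>"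
    using isCont_tendsto_compose[OF cont[OF s(1)] x] cA p_c by (simp add: coord_rep_apply)
  \<comment> \<open>Both estimates follow one pattern: the quantity to be bounded is written through
    transition maps in terms of the linearization, its limit is the same quantity for
    \<open>f\<close> at p, and that limit is strictly below \<open>\<epsilon>\<close>. The centre
    \<open>f\<^sub>0\<close> may differ from \<open>f\<close>.\<close>
  have "((\<lambda>z. norm (?\<tau> (?y z) - coord_rep c d' f\<^sub>0 (?x z))) \<longlongrightarrow>
      norm (?\<tau> (F a) - coord_rep c d' f\<^sub>0 a)) ?\<F>"
    by (intro tendsto_norm tendsto_diff isCont_tendsto_compose[OF cont[OF s(3)] y]
        isCont_tendsto_compose[OF cont[OF s(4)] x])
  moreover have "norm (?\<tau> (F a) - coord_rep c d' f\<^sub>0 a) < \<epsilon>"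
    using close0 by (simp add: F_a coord_rep_apply cA dA p_c fp_d)
  ultimately have ev0: "eventually (\<lambda>z. norm (?\<tau> (?y z) - coord_rep c d' f\<^sub>0 (?x z)) < \<epsilon>) ?\<F>"
    by (rule order_tendstoD)
  \<comment> \<open>The derivative in \<open>c'\<close> and \<open>d'\<close> is a product of three
    operators: two transition derivatives, continuous at the limit points, and the derivative of the
    linearization, controlled by the joint limit.\<close>
  have "((\<lambda>z. norm ((fderiv ?\<tau> (?y z) o\<^sub>L (fderiv (linearize F a (fst z)) (?x z) o\<^sub>L fderiv ?\<sigma>' (?\<sigma> (?x z))))
        - ?D\<^sub>0 (?\<sigma> (?x z)))) \<longlongrightarrow>
      norm ((fderiv ?\<tau> (F a) o\<^sub>L (fderiv F a o\<^sub>L fderiv ?\<sigma>' (snd c' p))) - ?D\<^sub>0 (snd c' p))) ?\<F>"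
    by (intro tendsto_norm tendsto_diff bounded_bilinear.tendsto[OF bounded_bilinear_blinfun_compose]
        y' isCont_tendsto_compose[OF C1_near_isCont_fderiv[OF s(3)] y]
        isCont_tendsto_compose[OF C1_near_isCont_fderiv[OF s(2)] sx]
        isCont_tendsto_compose[OF C1_near_isCont_fderiv[OF s(5)] sx])
  moreover have "norm ((fderiv ?\<tau> (F a) o\<^sub>L (fderiv F a o\<^sub>L fderiv ?\<sigma>' (snd c' p))) - ?D\<^sub>0 (snd c' p)) < \<epsilon>"
    using close1 fderiv_change_charts[OF C1_self_map_continuous[OF C1_f] c c' d d'(1)
        C1_near_coord_rep[OF C1_f c d]] unfolding F_a by metis
  ultimately have ev1: "eventually (\<lambda>z. norm ((fderiv ?\<tau> (?y z) o\<^sub>L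
      (fderiv (linearize F a (fst z)) (?x z) o\<^sub>L fderiv ?\<sigma>' (?\<sigma> (?x z)))) - ?D\<^sub>0 (?\<sigma> (?x z))) < \<epsilon>) ?\<F>"
    by (rule order_tendstoD)
  \<comment> \<open>The factorizations make sense only where the chart domains overlap; these are
    open conditions fulfilled in the limit, hence they hold eventually.\<close>
  have "open (snd c ` (fst c \<inter> fst c'))" "open (snd d ` (fst d \<inter> fst d'))"
    using cA dA A' by (auto intro!: open_chart_image chart_open)
  moreover have "a \<in> snd c ` (fst c \<inter> fst c')" "F a \<in> snd d ` (fst d \<inter> fst d')"
    using p_c fp_d A' F_a by auto
  ultimately have evc: "eventually (\<lambda>z. ?x z \<in> snd c ` (fst c \<inter> fst c')) ?\<F>"
    and evd: "eventually (\<lambda>z. ?y z \<in> snd d ` (fst d \<inter> fst d')) ?\<F>"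
    using topological_tendstoD[OF x] topological_tendstoD[OF y] by blast+
  have evW: "eventually (\<lambda>z. ?x z \<in> ball a \<delta>) ?\<F>"
    using topological_tendstoD[OF x open_ball] delta_pos by simp
  have "eventually (\<lambda>r::real. 0 < r \<and> 2 * r < \<delta>) (at_right 0)"
    using eventually_at_right_real[of 0 "\<delta> / 2"] delta_pos by (auto elim!: eventually_mono)
  then have evr: "eventually (\<lambda>z. 0 < fst z \<and> 2 * fst z < \<delta>) ?\<F>"
    by (rule eventually_compose_filterlim[OF _ filterlim_fst])
  show ?thesis
    using ev0 ev1 evc evd evW evr unfolding case_prod_beta'
  proof eventually_elim
    case (elim z)
    obtain r x where z: "z = (r, x)" by (cases z)
    have r: "0 < r" "2 * r < \<delta>" and xW: "x \<in> ball a \<delta>"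
      using elim by (auto simp: z)
    show ?case
      unfolding z fst_conv snd_conv
    proof (intro ballI impI)
      fix q assume q: "q \<in> fst c" "snd c q = x"
      then have W: "q \<in> W" using xW by blast
      have "x \<in> snd c ` (fst c \<inter> fst c')" using elim by (simp add: z)
      then have qc': "q \<in> fst c'"
        using q chart_inj[OF cA] by (auto dest: inj_onD)
      note flat = flat_W[OF r W] flat_chart[OF r W, unfolded q]
      have "snd d (flat r q) \<in> snd d ` (fst d \<inter> fst d')"
        using elim by (simp add: z flat)
      then have fd': "flat r q \<in> fst d'"
        using flat(1) chart_inj[OF dA] by (auto dest: inj_onD)
      have ch: "c \<in> charts_at A q" "c' \<in> charts_at A q" "d \<in> charts_at A (flat r q)"
        "d' \<in> charts_at A (flat r q)"
        using q qc' flat fd' cA dA A' by (auto simp: charts_at_iff)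
      have "?\<tau> (linearize F a r x) = snd d' (flat r q)"
        using coord_rep_apply[OF dA flat(1), of d' id] by (simp add: flat(2))
      moreover have "coord_rep c d' f\<^sub>0 x = snd d' (f\<^sub>0 q)"
        using coord_rep_apply[OF cA q(1), of d' f\<^sub>0] by (simp add: q(2))
      ultimately have 0: "norm (snd d' (flat r q) - snd d' (f\<^sub>0 q)) < \<epsilon>"
        using elim(1) by (simp add: z)
      have sx: "?\<sigma> x = snd c' q"
        using coord_rep_apply[OF cA q(1), of c' id] by (simp add: q(2))
      have "fderiv (coord_rep c' d' (flat r)) (snd c' q) =
          fderiv ?\<tau> (snd d (flat r q)) o\<^sub>L (fderiv (coord_rep c d (flat r)) (snd c q) o\<^sub>L fderiv ?\<sigma>' (snd c' q))"
        using C1_self_map_flat[OF r] ch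
        by (intro fderiv_change_charts C1_self_map_continuous C1_near_coord_rep)
      then have "fderiv (coord_rep c' d' (flat r)) (snd c' q) =
          fderiv ?\<tau> (linearize F a r x) o\<^sub>L (fderiv (linearize F a r) x o\<^sub>L fderiv ?\<sigma>' (?\<sigma> x))"
        using fderiv_coord_rep_flat[OF r xW] by (simp add: flat(2) q(2) sx)
      then have 1: "norm (fderiv (coord_rep c' d' (flat r)) (snd c' q) - ?D\<^sub>0 (snd c' q)) < \<epsilon>"
        using elim(2) by (simp add: z sx)
      show "flat r q \<in> fst d' \<and> norm (snd d' (flat r q) - snd d' (f\<^sub>0 q)) < \<epsilon> \<and>
          norm (fderiv (coord_rep c' d' (flat r)) (snd c' q) - ?D\<^sub>0 (snd c' q)) < \<epsilon>"
        using fd' 0 1 by blast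
    qed
  qed
qed

text \<open>Converts a joint limit into a statement about all of \<open>K r\<close>: its points have
  coordinates within \<open>2 * r\<close> of \<open>a\<close>, so for r below
  \<open>\<rho> / 2\<close> they all lie in the given neighborhood.\<close>

lemma eventually_on_K:
  assumes "eventually (\<lambda>(r, x). \<forall>q\<in>fst c. snd c q = x \<longrightarrow> P r q) (at_right 0 \<times>\<^sub>F nhds a)"
  shows "eventually (\<lambda>r. \<forall>q\<in>K r. P r q) (at_right 0)"
proof -
  obtain P1 P2 where P: "eventually P1 (at_right (0::real))" "eventually P2 (nhds a)"
    and PP: "\<And>r x. P1 r \<Longrightarrow> P2 x \<Longrightarrow> \<forall>q\<in>fst c. snd c q = x \<longrightarrow> P r q"
    using assms unfolding eventually_prod_filter by auto
  obtain \<rho> where \<rho>: "\<rho> > 0" "\<And>x. dist x a < \<rho> \<Longrightarrow> P2 x"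
    using P(2) unfolding eventually_nhds_metric by blast
  have "eventually (\<lambda>r::real. r \<in> {0<..<\<rho> / 2}) (at_right 0)"
    using \<rho>(1) by (intro eventually_at_right_real) simp
  with P(1) show ?thesis
  proof eventually_elim
    case (elim r)
    show ?case
    proof
      fix q assume q: "q \<in> K r"
      then have "dist (snd c q) a < \<rho>"
        using elim(2) by (auto simp: dist_commute)
      then show "P r q"
        using PP[OF elim(1) \<rho>(2)] q by blast
    qed
  qed
qed

text \<open>Off \<open>K r\<close> the map and its derivative agree with those of \<open>f\<close>,
  which satisfies the strict bounds by assumption. On \<open>K r\<close> the limit at p decides if p
  lies in \<open>L\<close>; otherwise \<open>K r\<close> eventually misses \<open>L\<close>.\<close>

lemma eventually_flat_in_subbasic:
  assumes f\<^sub>0: "f\<^sub>0 \<in> C1_maps X A" and c': "c' \<in> A" and d': "d' \<in> A"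
    and L: "compactin X L" "L \<subseteq> fst c'" "f\<^sub>0 ` L \<subseteq> fst d'"
    and fS: "f \<in> C1_subbasic X A f\<^sub>0 c' d' L \<epsilon>"
  shows "eventually (\<lambda>r. flat r \<in> C1_subbasic X A f\<^sub>0 c' d' L \<epsilon>) (at_right 0)"
proof -
  define close where "close g q \<longleftrightarrow> g q \<in> fst d' \<and> norm (snd d' (g q) - snd d' (f\<^sub>0 q)) < \<epsilon> \<and>
      norm (fderiv (coord_rep c' d' g) (snd c' q) - fderiv (coord_rep c' d' f\<^sub>0) (snd c' q)) < \<epsilon>" for g q
  have iff: "g \<in> C1_subbasic X A f\<^sub>0 c' d' L \<epsilon> \<longleftrightarrow> g \<in> C1_maps X A \<and> (\<forall>q\<in>L. close g q)" for g
    unfolding close_def by (rule C1_subbasic_iff[OF f\<^sub>0 c' d' L(2,3)])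
  have f_close: "close f q" if "q \<in> L" for q
    using fS that unfolding iff by blast
  have "eventually (\<lambda>(r, x). \<forall>q\<in>fst c. snd c q = x \<longrightarrow> (q \<in> L \<longrightarrow> close (flat r) q))
    (at_right 0 \<times>\<^sub>F nhds a)"
  proof (cases "p \<in> L")
    case True
    then have "eventually (\<lambda>(r, x). \<forall>q\<in>fst c. snd c q = x \<longrightarrow> close (flat r) q) (at_right 0 \<times>\<^sub>F nhds a)"
      unfolding close_def using f_close[OF True] c' d' L f\<^sub>0
      by (intro eventually_flat_close_at_p) (auto simp: charts_at_iff close_def)
    then show ?thesis
      by (rule eventually_mono) auto
  next
    case False
    \<comment> \<open>Since \<open>L\<close> is closed and avoids p, points of the chart
      \<open>c\<close> close enough to p are not in \<open>L\<close>, and the condition there is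
      vacuous.\<close>
    have "closedin X L"
      using L(1) mfd compactin_imp_closedin by (auto simp: smooth_manifold_def)
    then have "openin X (fst c - L)"
      using chart_open[OF cA] by (rule openin_diff[rotated])
    then have "open (snd c ` (fst c - L))"
      by (rule open_chart_image[OF cA]) blast
    then have "eventually (\<lambda>z. snd z \<in> snd c ` (fst c - L)) (at_right (0::real) \<times>\<^sub>F nhds a)"
      using p_c False by (intro topological_tendstoD[OF filterlim_snd]) auto
    then show ?thesis
    proof (rule eventually_mono)
      fix z :: "real \<times> 'e" assume "snd z \<in> snd c ` (fst c - L)"
      then have "\<forall>q\<in>fst c. snd c q = snd z \<longrightarrow> q \<notin> L"
        using chart_inj[OF cA] by (auto dest: inj_onD)
      then show "case z of (r, x) \<Rightarrow> \<forall>q\<in>fst c. snd c q = x \<longrightarrow> (q \<in> L \<longrightarrow> close (flat r) q)"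
        by (auto simp: case_prod_beta')
    qed
  qed
  then have "eventually (\<lambda>r. \<forall>q\<in>K r. q \<in> L \<longrightarrow> close (flat r) q) (at_right 0)"
    by (rule eventually_on_K)
  moreover have "eventually (\<lambda>r::real. r \<in> {0<..<\<delta> / 2}) (at_right 0)"
    using delta_pos by (intro eventually_at_right_real) simp
  ultimately show ?thesis
  proof eventually_elim
    case (elim r)
    have r: "0 < r" "2 * r < \<delta>" using elim(2) by auto
    have "close (flat r) q" if q: "q \<in> L" for q
    proof (cases "q \<in> K r")
      case True
      then show ?thesis using elim(1) q by blast
    next
      case False
      have "q \<in> topspace X - K r"
        using q L(1) False compactin_subset_topspace by blast
      moreover have "c' \<in> charts_at A q" "d' \<in> charts_at A (f q)"
        using q L(2) c' d' f_close[OF q] by (auto simp: charts_at_iff close_def)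
      ultimately show ?thesis
        using f_close[OF q] unfolding close_def flat_off[OF r False]
        by (simp only: fderiv_coord_rep_flat_off[OF r])
    qed
    then show ?case
      unfolding iff using flat_in_C1_maps[OF r] by blast
  qed
qed

text \<open>Eventual membership passes to finite intersections and to larger sets, so the generation
  of the topology reduces the claim to subbasic sets.\<close>

lemma eventually_flat_in_open:
  assumes "openin (C1_topology X A) \<W>" "f \<in> \<W>"
  shows "eventually (\<lambda>r. flat r \<in> \<W>) (at_right 0)"
  using openin_topology_generated_by[OF assms(1)[unfolded C1_topology_def]] assms(2)
proof induction
  case (Int U V)
  then have "eventually (\<lambda>r. flat r \<in> U) (at_right 0)" "eventually (\<lambda>r. flat r \<in> V) (at_right 0)"
    by auto
  then show ?case by eventually_elim blast
next
  case (UN \<K>)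
  then obtain U where "U \<in> \<K>" "eventually (\<lambda>r. flat r \<in> U) (at_right 0)"
    by blast
  then show ?case by (auto elim: eventually_mono)
next
  case (Basis S)
  then show ?case
    using eventually_flat_in_subbasic by blast
qed simp

end

section \<open>Choice of charts and radius, and conclusion\<close>

lemma (in manifold) exists_flattening:
  assumes "f \<in> C1_maps X A" "p \<in> topspace X"
  obtains c d \<delta> where "flattening X A f p c d \<delta>"
proof -
  have C1: "C1_self_map X A f" using assms(1) by (simp add: C1_maps_iff)
  note cont = C1_self_map_continuous[OF C1]
  have "f p \<in> topspace X"
    using continuous_map_funspace[OF cont] assms(2) by blast
  then obtain c d where c: "c \<in> charts_at A p" and d: "d \<in> charts_at A (f p)"
    using assms(2) charts_at_nonempty by metis
  then have cd: "c \<in> A" "d \<in> A" "p \<in> fst c" "f p \<in> fst d"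
    by (auto simp: charts_at_iff)
  define F where "F = coord_rep c d f"
  define a where "a = snd c p"
  have Fa: "F a = snd d (f p)"
    using cd by (simp add: F_def a_def coord_rep_apply)
  have "isCont F a"
    using C1_near_differentiable[OF C1_near_coord_rep[OF C1 c d]]
    unfolding F_def a_def by (rule differentiable_imp_continuous_within)
  from tendsto_linearize[OF this]
  \<comment> \<open>The limit value \<open>F a\<close> lies in the image of \<open>d\<close>, which
    is open, so nearby values of the interpolation do too, without any convexity.\<close>
  have "eventually (\<lambda>z. (case z of (r, x) \<Rightarrow> linearize F a r x) \<in> snd d ` fst d) (at_right (0::real) \<times>\<^sub>F nhds a)"
    by (rule topological_tendstoD) (use cd chart_open_image Fa in auto)
  then obtain P1 P2 where P: "eventually P1 (at_right (0::real))" "eventually P2 (nhds a)"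
    and PP: "\<And>r x. P1 r \<Longrightarrow> P2 x \<Longrightarrow> linearize F a r x \<in> snd d ` fst d"
    unfolding eventually_prod_filter by auto
  obtain \<delta>\<^sub>1 where d1: "\<delta>\<^sub>1 > 0" "\<And>r. 0 < r \<Longrightarrow> r < \<delta>\<^sub>1 \<Longrightarrow> P1 r"
    using P(1) unfolding eventually_at_right_field by blast
  obtain \<delta>\<^sub>2 where d2: "\<delta>\<^sub>2 > 0" "\<And>x. dist x a < \<delta>\<^sub>2 \<Longrightarrow> P2 x"
    using P(2) unfolding eventually_nhds_metric by blast
  have "a \<in> coord_dom c d f"
    using cd by (auto simp: coord_dom_def a_def)
  then obtain \<delta>\<^sub>3 where d3: "\<delta>\<^sub>3 > 0" "ball a \<delta>\<^sub>3 \<subseteq> coord_dom c d f"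
    using open_coord_dom[OF cont cd(1,2)] openE by blast
  \<comment> \<open>The three bounds limit, in order, the scale r, the distance of x from
    \<open>a\<close> for which the interpolation stays in the target chart, and the ball on which
    \<open>F\<close> is a genuine local representative.\<close>
  define \<delta> where "\<delta> = min \<delta>\<^sub>1 (min \<delta>\<^sub>2 \<delta>\<^sub>3)"
  have "flattening X A f p c d \<delta>"
  proof unfold_locales
    show "ball (snd c p) \<delta> \<subseteq> coord_dom c d f"
      using d3 by (auto simp: \<delta>_def a_def)
    show "linearize (coord_rep c d f) (snd c p) r x \<in> snd d ` fst d"
      if "0 < r" "r < \<delta>" "x \<in> ball (snd c p) \<delta>" for r x
      using that PP[OF d1(2) d2(2), unfolded F_def a_def] by (auto simp: \<delta>_def dist_commute)
  qed (use assms c d d1 d2 d3 in \<open>auto simp: \<delta>_def\<close>)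
  then show ?thesis using that by blast
qed

text \<open>A local form of the result: the interior is found at any prescribed critical point of
  f.\<close>

lemma (in manifold) exists_critical_interior:
  assumes f: "f \<in> C1_maps X A" and p: "p \<in> critical_set X A f"
    and U: "C1_neighborhood X A f \<U>"
  shows "\<exists>g\<in>\<U>. p \<in> X interior_of critical_set X A g"
proof -
  have "p \<in> topspace X" using p by (simp add: critical_set_def)
  then obtain c d \<delta> where "flattening X A f p c d \<delta>"
    using exists_flattening f by blast
  then interpret flattening X A f p c d \<delta> .
  obtain \<W> where W: "openin (C1_topology X A) \<W>" "f \<in> \<W>" "\<W> \<subseteq> \<U>"
    using U unfolding C1_neighborhood_def by blast
  have "eventually (\<lambda>r::real. r \<in> {0<..<\<delta> / 2}) (at_right 0)"
    using delta_pos by (intro eventually_at_right_real) simp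
  with eventually_flat_in_open[OF W(1,2)]
  have "eventually (\<lambda>r. flat r \<in> \<W> \<and> r \<in> {0<..<\<delta> / 2}) (at_right 0)"
    by (rule eventually_conj)
  \<comment> \<open>The filter of right neighborhoods of 0 is non-trivial, so a property holding
    eventually is realized by an actual radius.\<close>
  then obtain r where r: "flat r \<in> \<W>" "0 < r" "2 * r < \<delta>"
    using eventually_happens'[OF trivial_limit_at_right_real] by fastforce
  have "openin X {q \<in> fst c. snd c q \<in> ball a r}"
    by (rule openin_chart_vimage[OF cA open_ball])
  moreover have "p \<in> {q \<in> fst c. snd c q \<in> ball a r}"
    using p_c r by simp
  ultimately have "p \<in> X interior_of critical_set X A (flat r)"
    unfolding interior_of_def using ball_subset_critical_set[OF r(2,3) p] by blast
  then show ?thesis using r(1) W(3) by blast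
qed

theorem proposition1p1:
  fixes X :: "'a topology" and A :: "('a, real ^ 2) chart set" and f :: "'a \<Rightarrow> 'a"
  assumes "smooth_manifold X A" and "compact_space X"
    and "f \<in> C1_maps X A" and "persistent_critical_set X A f"
  shows "\<forall>\<U>. C1_neighborhood X A f \<U> \<longrightarrow>
           (\<exists>g\<in>\<U>. X interior_of critical_set X A g \<noteq> {})"
proof (intro allI impI)
  fix \<U> assume U: "C1_neighborhood X A f \<U>"
  interpret manifold X A by unfold_locales (fact assms(1))
  obtain p where "p \<in> critical_set X A f"
    using assms(4) unfolding persistent_critical_set_def C1_neighborhood_def by blast
  then show "\<exists>g\<in>\<U>. X interior_of critical_set X A g \<noteq> {}"
    using exists_critical_interior[OF assms(3) _ U] by blast
qed

end
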